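(* Let $d\ge 2$, let $H=SD<\mathrm{GL}(d,\mathbb{R})$ be a shearlet dilation group, let $G=\mathbb{R}^d\rtimes H$, and let $\mathcal{Q}:L^2(\mathbb{R}^d)\to L^2(\mathbb{R}^{d-1}\times\mathbb{R})$ be the unitary affine Radon transform. The unitary operator $\mathcal{Q}$ intertwines the shearlet representation $S_{b,s,a}$ with the tensor product of two unitary representations; precisely, for every $f\in L^2(\mathbb{R}^d)$ and every $(b,s,a)\in\mathbb{R}^d\times\mathbb{R}^{d-1}\times\mathbb{R}^\times$, $$\mathcal{Q}S_{b,s,a}f(v,t)=(V_{s,a}\otimes W_{n(v)\cdot b,a})\,\mathcal{Q}f(v,t)$$ for almost every $(v,t)\in\mathbb{R}^{d-1}\times\mathbb{R}$. Here, for $F\in L^2(\mathbb{R}^{d-1}\times\mathbb{R})$, $$(V_{s,a}\otimes W_{n(v)\cdot b,a})F(v,t)=|a|^{\frac{\lambda_D}{2}}|a|^{-\frac12}\,F\Big(\Lambda(a)\big({}^tB(s)v-s\big),\frac{t-n(v)\cdot b}{a}\Big).$$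
   Context: Notation: $\mathbb{R}^\times=\mathbb{R}\setminus\{0\}$; ${}^tA$ is the transpose; $\mathrm{T}(m,\mathbb{R})$ is the group of unipotent upper triangular $m\times m$ real matrices; vectors are column vectors; $x\cdot y$ is the Euclidean scalar product; $\mathcal{F}f(\xi)=\int f(x)e^{-2\pi i\xi\cdot x}\,dx$ is the Fourier transform. Shearlet dilation group: a subgroup $H=SD$ of $\mathrm{GL}(d,\mathbb{R})$ where (i) $S$ is a Lie subgroup of $\mathrm{T}(d,\mathbb{R})$ consisting of the matrices $\begin{bmatrix}1&-{}^ts\\0&B(s)\end{bmatrix}$, $s\in\mathbb{R}^{d-1}$, with $B:\mathbb{R}^{d-1}\to \mathrm{T}(d-1,\mathbb{R})$ a smooth map; (ii) $D$ is the group of diagonal matrices $a\begin{bmatrix}1&0\\0&\Lambda(a)\end{bmatrix}$, $a\in\mathbb{R}^\times$, where $\Lambda(a)=\mathrm{diag}(|a|^{\lambda_1},\dots,|a|^{\lambda_{d-1}})$ for a fixed $(\lambda_1,\dots,\lambda_{d-1})\in\mathbb{R}^{d-1}$. Put $\lambda_D=\lambda_1+\dots+\lambda_{d-1}$. The elements of $H$ are $h_{s,a}=a\begin{bmatrix}1&-{}^ts\Lambda(a)\\0&B(s)\Lambda(a)\end{bmatrix}$, $(s,a)\in\mathbb{R}^{d-1}\times\mathbb{R}^\times$. The group $G=\mathbb{R}^d\rtimes H$ has product $(b_1,h_1)(b_2,h_2)=(b_1+h_1b_2,h_1h_2)$ and its elements are written $(b,s,a)$, meaning $(b,h_{s,a})$.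 Representations: the shearlet representation of $G$ on $L^2(\mathbb{R}^d)$ is $S_{b,s,a}f(x)=|a|^{-\frac{d+\lambda_D}{2}}f(h_{s,a}^{-1}(x-b))$. The representation $V$ of $H$ on $L^2(\mathbb{R}^{d-1})$ is $V_{s,a}f(v)=|a|^{\frac{\lambda_D}{2}}f(\Lambda(a)({}^tB(s)v-s))$. The wavelet representation on $L^2(\mathbb{R})$ is $W_{\beta,a}f(x)=|a|^{-1/2}f(\frac{x-\beta}{a})$, $\beta\in\mathbb{R}$, $a\in\mathbb{R}^\times$. For $v\in\mathbb{R}^{d-1}$, ${}^tn(v)=(1,{}^tv)$, i.e. $n(v)=(1,v)\in\mathbb{R}^d$. Unitary affine Radon transform: for $f\in L^1(\mathbb{R}^d)$ the affine Radon transform is $\mathcal{R}^{\rm aff}f(v,t)=\int_{\mathbb{R}^{d-1}}f(t-v\cdot y,y)\,dy$, $(v,t)\in\mathbb{R}^{d-1}\times\mathbb{R}$ (for every $v$, defined for almost every $t$). Let $\mathcal{A}=\{f\in L^1(\mathbb{R}^d)\cap L^2(\mathbb{R}^d):\int_{\mathbb{R}^d}\frac{|\mathcal{F}f(\xi)|^2}{|\xi_1|^{d-1}}\,d\xi<+\infty\}$, with $\xi_1$ the first component of $\xi$; this is dense in $L^2(\mathbb{R}^d)$. Let $\mathcal{D}=\{f\in L^2(\mathbb{R}^{d-1}\times\mathbb{R}):\int|\tau|^{d-1}|\mathcal{F}f(\xi,\tau)|^2\,d\xi\,d\tau<+\infty\}$ and let $\mathcal{I}:\mathcal{D}\to L^2(\mathbb{R}^{d-1}\times\mathbb{R})$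 be defined by $\mathcal{F}\mathcal{I}f(\xi,\tau)=|\tau|^{\frac{d-1}{2}}\mathcal{F}f(\xi,\tau)$. For $f\in\mathcal{A}$ one has $\mathcal{R}^{\rm aff}f\in\mathcal{D}$, and $\mathcal{Q}$ denotes the unique unitary operator from $L^2(\mathbb{R}^d)$ onto $L^2(\mathbb{R}^{d-1}\times\mathbb{R})$ extending $\mathcal{A}\ni f\mapsto\mathcal{I}\mathcal{R}^{\rm aff}f$. *)

theory Defs
  imports "HOL-Analysis.Analysis" "HOL-Algebra.Group" "HOL-Library.Option_ord"
begin

text \<open>
  Dimensions.  The finite linearly ordered index type \<open>'n\<close> has \<open>d - 1\<close> elements, so \<open>\<real>\<close>-vectors of
  length \<open>d - 1\<close> are \<open>real ^ 'n\<close>, and vectors of length \<open>d\<close> are \<open>real ^ 'n option\<close>, where \<open>None\<close> is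
  the first coordinate (it is the least element of the order on \<open>'n option\<close>).  Types are
  nonempty, hence \<open>d \<ge> 2\<close>.
\<close>

definition vcons :: "real \<Rightarrow> real ^ 'n \<Rightarrow> real ^ ('n::finite) option"
  where "vcons x y = (\<chi> i. case i of None \<Rightarrow> x | Some k \<Rightarrow> y $ k)"

text \<open>\<open>block \<alpha> r c M\<close> has first row \<open>(\<alpha>, r)\<close>, and below it the column \<open>c\<close> and the matrix \<open>M\<close>.\<close>

definition block ::
    "real \<Rightarrow> real ^ 'n \<Rightarrow> real ^ 'n \<Rightarrow> real ^ 'n ^ 'n \<Rightarrow> real ^ ('n::finite) option ^ 'n option"
  where "block \<alpha> r c M =
    (\<chi> i j. case i of
        None \<Rightarrow> (case j of None \<Rightarrow> \<alpha> | Some l \<Rightarrow> r $ l)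
      | Some k \<Rightarrow> (case j of None \<Rightarrow> c $ k | Some l \<Rightarrow> M $ k $ l))"

definition nvec :: "real ^ 'n \<Rightarrow> real ^ ('n::finite) option"
  where "nvec v = vcons 1 v"

definition GL :: "(real ^ 'm ^ 'm::finite) monoid"
  where "GL = \<lparr>carrier = {A. invertible A}, monoid.mult = (**), one = mat 1\<rparr>"

definition unipotent_upper :: "(real ^ 'm::{finite,linorder} ^ 'm::{finite,linorder}) set"
  where "unipotent_upper = {A. (\<forall>i. A $ i $ i = 1) \<and> (\<forall>i j. j < i \<longrightarrow> A $ i $ j = 0)}"

text \<open>
  Lie subgroups are closed subgroups.  In the only use below the
  subgroup is the graph of a smooth map in global coordinates, hence automatically a closed
  embedded submanifold, so that other conventions for Lie subgroups give the same condition.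
\<close>

definition lie_subgroup :: "(real ^ 'm ^ 'm::finite) set \<Rightarrow> (real ^ 'm ^ 'm) set \<Rightarrow> bool"
  where "lie_subgroup S T \<longleftrightarrow> S \<subseteq> T \<and> subgroup S GL \<and> closedin (top_of_set T) S"

fun Ck :: "nat \<Rightarrow> ('a::euclidean_space \<Rightarrow> 'b::real_normed_vector) \<Rightarrow> bool"
  where
    "Ck 0 f \<longleftrightarrow> continuous_on UNIV f"
  | "Ck (Suc k) f \<longleftrightarrow>
      (\<forall>x. f differentiable (at x)) \<and> (\<forall>v. Ck k (\<lambda>x. frechet_derivative f (at x) v))"

definition smooth_map :: "('a::euclidean_space \<Rightarrow> 'b::real_normed_vector) \<Rightarrow> bool"
  where "smooth_map f \<longleftrightarrow> (\<forall>k. Ck k f)"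

definition Lam :: "real ^ 'n \<Rightarrow> real \<Rightarrow> real ^ 'n ^ ('n::finite)"
  where "Lam lam a = (\<chi> i j. if i = j then \<bar>a\<bar> powr (lam $ i) else 0)"

definition lamD :: "real ^ ('n::finite) \<Rightarrow> real"
  where "lamD lam = (\<Sum>i\<in>UNIV. lam $ i)"

definition shear_mat ::
    "(real ^ 'n \<Rightarrow> real ^ 'n ^ 'n) \<Rightarrow> real ^ 'n \<Rightarrow> real ^ ('n::finite) option ^ 'n option"
  where "shear_mat B s = block 1 (- s) 0 (B s)"

definition dil_mat :: "real ^ 'n \<Rightarrow> real \<Rightarrow> real ^ ('n::finite) option ^ 'n option"
  where "dil_mat lam a = a *\<^sub>R block 1 0 0 (Lam lam a)"

definition hmat ::
    "(real ^ 'n \<Rightarrow> real ^ 'n ^ 'n) \<Rightarrow> real ^ 'n \<Rightarrow> real ^ 'n \<Rightarrow> real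
      \<Rightarrow> real ^ ('n::finite) option ^ 'n option"
  where "hmat B lam s a = a *\<^sub>R block 1 (- (s v* Lam lam a)) 0 (B s ** Lam lam a)"

definition shearlet_dilation_group ::
    "(real ^ ('n::{finite,linorder}) option ^ 'n option) set
      \<Rightarrow> (real ^ 'n::{finite,linorder} \<Rightarrow> real ^ 'n::{finite,linorder} ^ 'n::{finite,linorder})
      \<Rightarrow> real ^ 'n::{finite,linorder} \<Rightarrow> bool"
  where "shearlet_dilation_group H B lam \<longleftrightarrow>
    smooth_map B \<and> range B \<subseteq> unipotent_upper \<and>
    lie_subgroup (range (shear_mat B)) unipotent_upper \<and>
    H = {A ** C | A C. A \<in> range (shear_mat B) \<and> C \<in> dil_mat lam ` (- {0})} \<and>
    subgroup H GL"

text \<open>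
  Elements of \<open>L\<^sup>p\<close> are represented by Borel functions; equality in \<open>L\<^sup>p\<close> is
  equality almost everywhere.
\<close>

definition L1 :: "('a::euclidean_space \<Rightarrow> complex) set"
  where "L1 = {f. integrable lborel f}"

definition L2 :: "('a::euclidean_space \<Rightarrow> complex) set"
  where "L2 = {f. f \<in> borel_measurable lborel \<and> integrable lborel (\<lambda>x. (norm (f x))\<^sup>2)}"

definition L2_inner ::
    "('a::euclidean_space \<Rightarrow> complex) \<Rightarrow> ('a \<Rightarrow> complex) \<Rightarrow> complex"
  where "L2_inner f g = (LINT x|lborel. f x * cnj (g x))"

definition L2_tendsto ::
    "(nat \<Rightarrow> 'a::euclidean_space \<Rightarrow> complex) \<Rightarrow> ('a \<Rightarrow> complex) \<Rightarrow> bool"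
  where "L2_tendsto \<phi> f \<longleftrightarrow>
    (\<lambda>n. \<integral>\<^sup>+x. ennreal ((norm (\<phi> n x - f x))\<^sup>2) \<partial>lborel) \<longlonglongrightarrow> 0"

definition L2_unitary ::
    "(('a::euclidean_space \<Rightarrow> complex) \<Rightarrow> 'b::euclidean_space \<Rightarrow> complex) \<Rightarrow> bool"
  where "L2_unitary U \<longleftrightarrow>
    (\<forall>f\<in>L2. U f \<in> L2) \<and>
    (\<forall>f\<in>L2. \<forall>g\<in>L2. (AE x in lborel. f x = g x) \<longrightarrow> (AE y in lborel. U f y = U g y)) \<and>
    (\<forall>f\<in>L2. \<forall>g\<in>L2. AE y in lborel. U (\<lambda>x. f x + g x) y = U f y + U g y) \<and>
    (\<forall>f\<in>L2. \<forall>c. AE y in lborel. U (\<lambda>x. c * f x) y = c * U f y) \<and>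
    (\<forall>f\<in>L2. \<forall>g\<in>L2. L2_inner (U f) (U g) = L2_inner f g) \<and>
    (\<forall>g\<in>L2. \<exists>f\<in>L2. AE y in lborel. U f y = g y)"

definition fourier :: "('a::euclidean_space \<Rightarrow> complex) \<Rightarrow> 'a \<Rightarrow> complex"
  where "fourier f \<xi> = (LINT x|lborel. f x * exp (- 2 * of_real pi * \<i> * of_real (\<xi> \<bullet> x)))"

text \<open>
  The graph of the Fourier transform on \<open>L\<^sup>2\<close>: the extension by continuity from \<open>L\<^sup>1 \<inter> L\<^sup>2\<close>
  of the integral formula (Plancherel), so \<open>fourier_L2 f g\<close> says that \<open>g\<close> is the Fourier
  transform of \<open>f\<close> in \<open>L\<^sup>2\<close>.
\<close>

definition fourier_L2 :: "('a::euclidean_space \<Rightarrow> complex) \<Rightarrow> ('a \<Rightarrow> complex) \<Rightarrow> bool"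
  where "fourier_L2 f g \<longleftrightarrow> f \<in> L2 \<and> g \<in> L2 \<and>
    (\<exists>\<phi>. (\<forall>n. \<phi> n \<in> L1 \<inter> L2) \<and> L2_tendsto \<phi> f \<and> L2_tendsto (\<lambda>n. fourier (\<phi> n)) g)"

definition radon_aff ::
    "(real ^ 'n option \<Rightarrow> complex) \<Rightarrow> (real ^ 'n::finite) \<times> real \<Rightarrow> complex"
  where "radon_aff f = (\<lambda>(v, t). LINT y|lborel. f (vcons (t - v \<bullet> y) y))"

text \<open>In the next three definitions \<open>d - 1\<close> appears as \<open>CARD('n)\<close>.\<close>

definition dom_A :: "(real ^ ('n::finite) option \<Rightarrow> complex) set"
  where "dom_A = {f \<in> L1 \<inter> L2.
    integrable lborel (\<lambda>\<xi>. (norm (fourier f \<xi>))\<^sup>2 / \<bar>\<xi> $ None\<bar> ^ CARD('n))}"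

definition dom_D :: "((real ^ 'n::finite) \<times> real \<Rightarrow> complex) set"
  where "dom_D = {f \<in> L2. \<exists>g. fourier_L2 f g \<and>
    integrable lborel (\<lambda>(\<xi>, \<tau>). \<bar>\<tau>\<bar> ^ CARD('n) * (norm (g (\<xi>, \<tau>)))\<^sup>2)}"

text \<open>The graph of \<open>\<I> : \<D> \<rightarrow> L\<^sup>2\<close>: \<open>op_I f h\<close> says that \<open>f \<in> \<D>\<close> and \<open>\<I> f = h\<close>.\<close>

definition op_I ::
    "((real ^ 'n) \<times> real \<Rightarrow> complex) \<Rightarrow> ((real ^ 'n::finite) \<times> real \<Rightarrow> complex) \<Rightarrow> bool"
  where "op_I f h \<longleftrightarrow> f \<in> dom_D \<and> h \<in> L2 \<and>
    (\<exists>f' h'. fourier_L2 f f' \<and> fourier_L2 h h' \<and>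
      (AE (\<xi>, \<tau>) in lborel. h' (\<xi>, \<tau>) = of_real (\<bar>\<tau>\<bar> powr (real CARD('n) / 2)) * f' (\<xi>, \<tau>)))"

text \<open>
  The operator is characterised (uniquely up to almost everywhere equality, because \<open>\<A>\<close> is
  dense in \<open>L\<^sup>2\<close>) as the unitary operator extending \<open>\<I> \<circ> \<R>\<^sup>a\<^sup>f\<^sup>f\<close> from \<open>\<A>\<close>.
\<close>

definition unitary_affine_radon ::
    "((real ^ 'n option \<Rightarrow> complex) \<Rightarrow> (real ^ 'n::finite) \<times> real \<Rightarrow> complex) \<Rightarrow> bool"
  where "unitary_affine_radon Q \<longleftrightarrow>
    L2_unitary Q \<and> (\<forall>f\<in>dom_A. op_I (radon_aff f) (Q f))"

text \<open>Here \<open>CARD('n option)\<close> is \<open>d\<close>.\<close>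

definition shearlet_rep ::
    "(real ^ 'n \<Rightarrow> real ^ 'n ^ 'n) \<Rightarrow> real ^ 'n \<Rightarrow> real ^ 'n option \<Rightarrow> real ^ 'n \<Rightarrow> real
      \<Rightarrow> (real ^ 'n option \<Rightarrow> complex) \<Rightarrow> real ^ ('n::finite) option \<Rightarrow> complex"
  where "shearlet_rep B lam b s a f x =
    of_real (\<bar>a\<bar> powr (- (real CARD('n option) + lamD lam) / 2))
      * f (matrix_inv (hmat B lam s a) *v (x - b))"

definition V_rep ::
    "(real ^ 'n \<Rightarrow> real ^ 'n ^ 'n) \<Rightarrow> real ^ 'n \<Rightarrow> real ^ 'n \<Rightarrow> real
      \<Rightarrow> (real ^ 'n \<Rightarrow> complex) \<Rightarrow> real ^ ('n::finite) \<Rightarrow> complex"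
  where "V_rep B lam s a f v =
    of_real (\<bar>a\<bar> powr (lamD lam / 2)) * f (Lam lam a *v (transpose (B s) *v v - s))"

definition W_rep :: "real \<Rightarrow> real \<Rightarrow> (real \<Rightarrow> complex) \<Rightarrow> real \<Rightarrow> complex"
  where "W_rep \<beta> a f x = of_real (\<bar>a\<bar> powr (- 1 / 2)) * f ((x - \<beta>) / a)"

text \<open>
  The translation parameter \<open>n(v) \<cdot> b\<close> of the wavelet factor is taken at the outer point \<open>v\<close>,
  not at the point to which \<open>V\<close> moves it; see the explicit formula below.
\<close>

definition VW_rep ::
    "(real ^ 'n \<Rightarrow> real ^ 'n ^ 'n) \<Rightarrow> real ^ 'n \<Rightarrow> real ^ 'n option \<Rightarrow> real ^ 'n \<Rightarrow> real
      \<Rightarrow> ((real ^ 'n) \<times> real \<Rightarrow> complex) \<Rightarrow> (real ^ 'n::finite) \<times> real \<Rightarrow> complex"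
  where "VW_rep B lam b s a F =
    (\<lambda>(v, t). V_rep B lam s a (\<lambda>v'. W_rep (nvec v \<bullet> b) a (\<lambda>t'. F (v', t')) t) v)"

lemma VW_rep_apply:
  "VW_rep B lam b s a F (v, t) =
    of_real (\<bar>a\<bar> powr (lamD lam / 2)) * of_real (\<bar>a\<bar> powr (- 1 / 2))
      * F (Lam lam a *v (transpose (B s) *v v - s), (t - nvec v \<bullet> b) / a)"
  by (simp add: VW_rep_def V_rep_def W_rep_def)

lemma sum_UNIV_option:
  "(\<Sum>i\<in>UNIV. g i) = g None + (\<Sum>k\<in>UNIV. g (Some k))"
  for g :: "'n::finite option \<Rightarrow> 'b::comm_monoid_add"
  by (simp add: UNIV_option_conv sum.reindex)

lemma hmat_eq_shear_dil: "hmat B lam s a = shear_mat B s ** dil_mat lam a"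
proof -
  have "hmat B lam s a $ i $ j = (shear_mat B s ** dil_mat lam a) $ i $ j" for i j
    by (cases i; cases j)
      (simp_all add: hmat_def shear_mat_def dil_mat_def block_def matrix_matrix_mult_def
        vector_matrix_mult_def sum_UNIV_option sum_distrib_left sum_negf mult_ac)
  then show ?thesis by (simp add: vec_eq_iff)
qed

end

(*
  Q is the closure of I R on A, so it suffices to prove the identity on A, which is dense, and there it
  follows from two covariance properties.  The substitution y = b' + a B(s) Lambda(a) z turns
  R(S f) into a multiple of (R f) o T, where T is an affine bijection of R^(d-1) x R (linear in v also in the
  translation n(v).b).  The adjoint inverse of the linear part of T multiplies tau by a, so that
  I commutes with composition by T up to a power of |a|; no partial Fourier transform is needed.
  Uniqueness and injectivity of the Fourier transform on L2, as well as the density of A, rest on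
  the Plancherel theorem, which follows from Gaussian regularisation.
*)
theory Submission
  imports Defs "HOL-Probability.Characteristic_Functions"
begin

section \<open>Scaling of Lebesgue measure\<close>

text \<open>The maps act on several Euclidean spaces, one of them a product, so their effect on
  measure comes from uniqueness of translation invariant measures instead of determinants. Mostly
  the existence of a scaling constant suffices: that of T occurs both in the Fourier transform of (R
  f) o T and in that of (I R f) o T and cancels, and in the density argument it only bounds
  operators. The constant whose value enters the result is that of z -> a B(s) Lambda(a) z, to which
  the unipotent B(s) contributes the factor 1. The powers of |a| balance thus: the Jacobian
  |a|^(d-1+lambda_D) times the normalisation |a|^(-(d+lambda_D)/2) of S gives |a|^((d-2+lambda_D)/2)
  for the Radon transform; commuting with I gives |a|^(-(d-1)/2); the product is the factor
  |a|^((lambda_D-1)/2) of V and W. The obstacle to the density of A is that cutting off small xi_1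
  in frequency may leave L^1. Trigonometric polynomials in xi_1 are safe multipliers, because they
  act as finite combinations of translations.\<close>

lemma translation_invariant_measure_unique:
  fixes M :: "'a::euclidean_space measure"
  assumes "sigma_finite_measure M" and sets [measurable_cong]: "sets M = sets borel"
    and inv: "\<And>w. distr M borel (\<lambda>x. x + w) = M"
    and [measurable]: "A \<in> sets borel" "B \<in> sets borel"
  shows "emeasure M A * emeasure lborel B = emeasure lborel A * emeasure M (uminus -` B)"
proof -
  interpret M: sigma_finite_measure M by fact
  interpret pair_sigma_finite M lborel ..
  have [simp]: "space M = UNIV"
    using sets_eq_imp_space_eq[OF sets] by simp
  have [measurable]: "uminus -` B \<in> sets borel"
    using measurable_sets[of uminus borel borel B] by simp
  have shift: "(\<integral>\<^sup>+x. f (x + w) \<partial>M) = (\<integral>\<^sup>+x. f x \<partial>M)"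
    if [measurable]: "f \<in> borel_measurable borel" for f :: "'a \<Rightarrow> ennreal" and w
  proof -
    have "(\<integral>\<^sup>+x. f x \<partial>M) = (\<integral>\<^sup>+x. f x \<partial>distr M borel (\<lambda>x. x + w))" by (simp add: inv)
    then show ?thesis by (subst (asm) nn_integral_distr) auto
  qed
  have shift': "(\<integral>\<^sup>+x. f (w + x) \<partial>lborel) = (\<integral>\<^sup>+x. f x \<partial>lborel)"
    if [measurable]: "f \<in> borel_measurable borel" for f :: "'a \<Rightarrow> ennreal" and w
  proof -
    have "(\<integral>\<^sup>+x. f x \<partial>lborel) = (\<integral>\<^sup>+x. f x \<partial>distr lborel borel ((+) w))"
      by (simp add: lborel_distr_plus)
    then show ?thesis by (subst (asm) nn_integral_distr) auto
  qed
  \<comment> \<open>The product of the two indicators is sheared twice: x is replaced by x + y using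
    invariance of \<open>M\<close>, then y by y - x using invariance of \<open>lborel\<close>. As a
    function of x, the factor 1_B(y - x) is a translate of the indicator of -B, which is where the
    reflection comes from.\<close>
  have "emeasure M A * emeasure lborel B
      = (\<integral>\<^sup>+y. (\<integral>\<^sup>+x. indicator A x * indicator B y \<partial>M) \<partial>lborel)"
    by (simp add: nn_integral_multc nn_integral_cmult sets)
  also have "\<dots> = (\<integral>\<^sup>+y. (\<integral>\<^sup>+x. indicator A (x + y) * indicator B y \<partial>M) \<partial>lborel)"
    by (intro nn_integral_cong shift[symmetric]) simp
  also have "\<dots> = (\<integral>\<^sup>+x. (\<integral>\<^sup>+y. indicator A (x + y) * indicator B y \<partial>lborel) \<partial>M)"
    by (rule Fubini') simp
  also have "\<dots> = (\<integral>\<^sup>+x. (\<integral>\<^sup>+y. indicator A y * indicator B (y - x) \<partial>lborel) \<partial>M)"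
  proof (rule nn_integral_cong)
    fix x
    show "(\<integral>\<^sup>+y. indicator A (x + y) * indicator B y \<partial>lborel)
        = (\<integral>\<^sup>+y. indicator A y * indicator B (y - x) \<partial>lborel)"
      using shift'[of "\<lambda>y. indicator A y * indicator B (y - x)" x] by simp
  qed
  also have "\<dots> = (\<integral>\<^sup>+y. (\<integral>\<^sup>+x. indicator A y * indicator B (y - x) \<partial>M) \<partial>lborel)"
    by (rule Fubini'[symmetric]) simp
  also have "\<dots> = (\<integral>\<^sup>+y. indicator A y * emeasure M (uminus -` B) \<partial>lborel)"
  proof (rule nn_integral_cong)
    fix y
    have "(\<integral>\<^sup>+x. indicator B (y - x) \<partial>M) = (\<integral>\<^sup>+x. indicator (uminus -` B) (x + (- y)) \<partial>M)"
      by (intro nn_integral_cong) (auto simp: indicator_def)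
    also have "\<dots> = emeasure M (uminus -` B)"
      by (subst shift) (auto simp: sets)
    finally show "(\<integral>\<^sup>+x. indicator A y * indicator B (y - x) \<partial>M)
        = indicator A y * emeasure M (uminus -` B)"
      by (simp add: nn_integral_cmult)
  qed
  also have "\<dots> = emeasure lborel A * emeasure M (uminus -` B)"
    by (simp add: nn_integral_multc)
  finally show ?thesis .
qed

text \<open>\<open>scales_lborel T c\<close> means \<open>\<integral> f (T x) dx = c \<integral> f x dx\<close>, so \<open>c\<close> is the reciprocal of the
  Jacobian of \<open>T\<close>.\<close>

definition scales_lborel :: "('a::euclidean_space \<Rightarrow> 'a) \<Rightarrow> real \<Rightarrow> bool"
  where "scales_lborel T c \<longleftrightarrow> T \<in> borel_measurable borel \<and> 0 < c \<and>
    distr lborel borel T = density lborel (\<lambda>_. ennreal c)"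

lemma
  assumes "scales_lborel T c"
  shows scales_measurable: "T \<in> borel_measurable borel" and scales_pos: "0 < c"
    and scales_distr: "distr lborel borel T = density lborel (\<lambda>_. ennreal c)"
  using assms by (auto simp: scales_lborel_def)

lemma scales_nn_integral:
  assumes "scales_lborel T c" and [measurable]: "f \<in> borel_measurable borel"
  shows "(\<integral>\<^sup>+x. f (T x) \<partial>lborel) = ennreal c * (\<integral>\<^sup>+x. f x \<partial>lborel)"
proof -
  note [measurable] = scales_measurable[OF assms(1)]
  have "(\<integral>\<^sup>+x. f (T x) \<partial>lborel) = (\<integral>\<^sup>+x. f x \<partial>distr lborel borel T)"
    by (subst nn_integral_distr) auto
  also have "\<dots> = ennreal c * (\<integral>\<^sup>+x. f x \<partial>lborel)"
    by (simp add: scales_distr[OF assms(1)] nn_integral_density nn_integral_cmult)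
  finally show ?thesis .
qed

lemma scales_integrable:
  fixes f :: "'a::euclidean_space \<Rightarrow> 'b::{banach, second_countable_topology}"
  assumes "scales_lborel T c" and f: "integrable lborel f"
  shows "integrable lborel (\<lambda>x. f (T x))"
proof -
  note [measurable] = scales_measurable[OF assms(1)] borel_measurable_integrable[OF f]
  have "integrable (distr lborel borel T) f"
    using f scales_pos[OF assms(1)]
    by (simp add: scales_distr[OF assms(1)] integrable_density)
  then show ?thesis by (subst (asm) integrable_distr_eq) auto
qed

lemma scales_integral:
  fixes f :: "'a::euclidean_space \<Rightarrow> 'b::{banach, second_countable_topology}"
  assumes "scales_lborel T c" and [measurable]: "f \<in> borel_measurable borel"
  shows "(LINT x|lborel. f (T x)) = c *\<^sub>R (LINT x|lborel. f x)"
proof -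
  note [measurable] = scales_measurable[OF assms(1)]
  have "(LINT x|lborel. f (T x)) = (LINT x|distr lborel borel T. f x)"
    by (subst integral_distr) auto
  also have "\<dots> = c *\<^sub>R (LINT x|lborel. f x)"
    using scales_pos[OF assms(1)]
    by (simp add: scales_distr[OF assms(1)] integral_density)
  finally show ?thesis .
qed

lemma scales_AE:
  assumes "scales_lborel T c" and "AE x in lborel. P x"
  shows "AE x in lborel. P (T x)"
proof -
  note [measurable] = scales_measurable[OF assms(1)]
  obtain N where N: "{x. \<not> P x} \<subseteq> N" "emeasure lborel N = 0" "N \<in> sets borel"
    using assms(2) by (auto elim!: AE_E)
  have "AE x in density lborel (\<lambda>_. ennreal c). x \<notin> N"
    using N(2,3) by (subst AE_density) (auto intro!: AE_I'[of N] simp: null_sets_def)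
  then have "AE x in distr lborel borel T. x \<notin> N"
    unfolding scales_distr[OF assms(1)] .
  then have "AE x in lborel. T x \<notin> N"
    using N(3) by (subst (asm) AE_distr_iff) auto
  then show ?thesis using N(1) by (auto elim!: eventually_mono)
qed

lemma scales_compose:
  assumes "scales_lborel S c" "scales_lborel T d"
  shows "scales_lborel (\<lambda>x. S (T x)) (c * d)"
proof -
  note [measurable] = scales_measurable[OF assms(1)] scales_measurable[OF assms(2)]
  have "distr lborel borel (\<lambda>x. S (T x)) = density lborel (\<lambda>_. ennreal (c * d))"
  proof (rule measure_eqI)
    fix A assume "A \<in> sets (distr lborel borel (\<lambda>x. S (T x)))"
    then have [measurable]: "A \<in> sets borel" by simp
    have "emeasure (distr lborel borel (\<lambda>x. S (T x))) A = (\<integral>\<^sup>+x. indicator A (S (T x)) \<partial>lborel)"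
      by (simp flip: nn_integral_indicator add: nn_integral_distr)
    also have "\<dots> = ennreal d * (ennreal c * emeasure lborel A)"
      using scales_nn_integral[OF assms(2), of "\<lambda>y. indicator A (S y)"]
        scales_nn_integral[OF assms(1), of "indicator A"] by simp
    also have "\<dots> = emeasure (density lborel (\<lambda>_. ennreal (c * d))) A"
      using scales_pos[OF assms(1)] scales_pos[OF assms(2)]
      by (simp add: emeasure_density nn_integral_cmult ennreal_mult mult_ac)
    finally show "emeasure (distr lborel borel (\<lambda>x. S (T x))) A
        = emeasure (density lborel (\<lambda>_. ennreal (c * d))) A" .
  qed simp
  then show ?thesis using assms by (simp add: scales_lborel_def)
qed

lemma emeasure_lborel_ball_nonzero:
  assumes "0 < r"
  shows "emeasure lborel (ball (x::'a::euclidean_space) r) \<noteq> 0"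
proof -
  have "0 < Gamma (real DIM('a) / 2 + 1)"
    by (intro Gamma_real_pos) (auto intro: add_nonneg_pos)
  then show ?thesis using assms by (simp add: emeasure_ball unit_ball_vol_def ennreal_eq_0_iff not_le)
qed

lemma scales_affine:
  assumes "r \<noteq> 0"
  shows "scales_lborel (\<lambda>x::'a::euclidean_space. w + r *\<^sub>R x) (inverse (\<bar>r\<bar> ^ DIM('a)))"
proof -
  have "density lborel (\<lambda>_. ennreal (inverse (\<bar>r\<bar> ^ DIM('a))))
      = density (density (distr lborel borel (\<lambda>x::'a. w + r *\<^sub>R x)) (\<lambda>_. ennreal (\<bar>r\<bar> ^ DIM('a))))
          (\<lambda>_. ennreal (inverse (\<bar>r\<bar> ^ DIM('a))))"
    by (simp flip: lborel_affine[OF assms])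
  also have "\<dots> = density (distr lborel borel (\<lambda>x::'a. w + r *\<^sub>R x)) (\<lambda>_. 1)"
    using assms
    by (subst density_density_eq) (auto simp flip: ennreal_mult simp del: ennreal_power)
  finally show ?thesis using assms by (simp add: scales_lborel_def density_1)
qed

lemma scales_translation: "scales_lborel (\<lambda>x. w + x) 1"
  using scales_affine[of 1 w] by simp

text \<open>The image measure of \<open>lborel\<close> under \<open>L\<close> is again translation
  invariant, hence proportional to \<open>lborel\<close>. Testing on the unit ball, which equals its
  own reflection, gives the factor.\<close>

lemma scales_linear:
  fixes L :: "'a::euclidean_space \<Rightarrow> 'a"
  assumes L: "linear L" "inj L"
  shows "scales_lborel L (measure lborel (L -` ball 0 1) / measure lborel (ball (0::'a) 1))"
proof -
  define M where "M = distr lborel borel L"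
  define B where "B = ball (0::'a) 1"
  have [measurable]: "L \<in> borel_measurable borel"
    by (simp add: L(1) borel_measurable_continuous_onI linear_continuous_on linear_conv_bounded_linear[symmetric])
  have [simp]: "space M = UNIV" "sets M = sets borel" by (simp_all add: M_def)
  obtain k where k: "0 < k" "\<And>x. k * norm x \<le> norm (L x)"
    using linear_inj_bounded_below_pos[OF L] by blast
  \<comment> \<open>An injective linear map is bounded below, so preimages of balls are bounded.
    Balls of integer radius then witness that \<open>M\<close> is sigma-finite.\<close>
  have fin: "emeasure M (ball 0 r) < \<infinity>" for r
  proof -
    have "L -` ball 0 r \<subseteq> ball 0 (r / k)"
      using k by (auto simp: pos_less_divide_eq mult.commute[of _ k] intro: le_less_trans[OF k(2)])
    then have "emeasure lborel (L -` ball 0 r) \<le> emeasure lborel (ball (0::'a) (r / k))"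
      by (intro emeasure_mono) auto
    also have "\<dots> < \<infinity>" by (rule emeasure_lborel_ball_finite)
    finally show ?thesis by (simp add: M_def emeasure_distr)
  qed
  have "sigma_finite_measure M"
  proof
    show "\<exists>A. countable A \<and> A \<subseteq> sets M \<and> \<Union> A = space M \<and> (\<forall>a\<in>A. emeasure M a \<noteq> \<infinity>)"
      using fin reals_Archimedean2
      by (intro exI[of _ "range (\<lambda>n. ball 0 (real n))"]) (auto simp: less_top)
  qed
  \<comment> \<open>Surjectivity of \<open>L\<close> turns a translation by w in the image into a
    translation by some v in the source.\<close>
  moreover have "distr M borel (\<lambda>x. x + w) = M" for w
  proof -
    obtain v where v: "w = L v"
      using linear_injective_imp_surjective[OF L] by (auto simp: surj_def)
    have "distr M borel (\<lambda>x. x + w) = distr lborel borel (\<lambda>x. L (v + x))"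
      using L(1) by (simp add: M_def distr_distr o_def v linear_add add.commute)
    also have "\<dots> = distr (distr lborel borel ((+) v)) borel L"
      by (simp add: distr_distr o_def)
    finally show ?thesis by (simp add: lborel_distr_plus M_def)
  qed
  ultimately have eq: "emeasure M A * emeasure lborel B = emeasure lborel A * emeasure M B"
    if "A \<in> sets borel" for A
    using translation_invariant_measure_unique[of M A B] that
    by (simp add: B_def vimage_def ball_def)
  have B: "emeasure lborel B \<noteq> 0" "emeasure lborel B \<noteq> \<infinity>"
    using emeasure_lborel_ball_finite[of "0::'a" 1] emeasure_lborel_ball_nonzero[of 1 "0::'a"]
    by (auto simp: B_def)
  have posB: "0 < measure lborel B"
    using B by (simp add: measure_def enn2real_positive_iff less_top zero_less_iff_neq_zero)
  have MB: "emeasure M B = ennreal (measure lborel (L -` B))"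
    using fin[of 1] by (simp add: B_def M_def emeasure_distr measure_def)
  \<comment> \<open>Were it zero, proportionality would give the whole space measure zero under
    \<open>M\<close>, although its preimage is the whole space.\<close>
  have "emeasure M B \<noteq> 0"
  proof
    assume "emeasure M B = 0"
    then have "emeasure M UNIV = 0"
      using eq[of UNIV] B by simp
    then have "emeasure lborel (UNIV :: 'a set) = 0"
      by (simp add: M_def emeasure_distr)
    then show False by simp
  qed
  then have pos: "0 < measure lborel (L -` B)"
    using MB by (auto simp: ennreal_eq_0_iff not_le)
  define c where "c = measure lborel (L -` B) / measure lborel B"
  have "M = density lborel (\<lambda>_. ennreal c)"
  proof (rule measure_eqI)
    fix A assume "A \<in> sets M"
    then have A[measurable]: "A \<in> sets borel" by simp
    have "emeasure lborel B = ennreal (measure lborel B)"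
      using B by (simp add: measure_def less_top)
    then have cB: "ennreal c * emeasure lborel B = emeasure M B"
      using posB by (simp add: c_def MB flip: ennreal_mult'')
    then have "emeasure M A * emeasure lborel B = (ennreal c * emeasure lborel A) * emeasure lborel B"
      unfolding eq[OF A] cB[symmetric] by (simp add: mult_ac)
    then have "emeasure M A = ennreal c * emeasure lborel A"
      using B by (metis ennreal_mult_cancel_left mult.commute infinity_ennreal_def)
    then show "emeasure M A = emeasure (density lborel (\<lambda>_. ennreal c)) A"
      by (simp add: emeasure_density nn_integral_cmult)
  qed simp
  then show ?thesis
    using posB pos by (simp add: scales_lborel_def M_def c_def B_def)
qed

lemma scales_linear_ex:
  fixes L :: "'a::euclidean_space \<Rightarrow> 'a"
  assumes "linear L" "inj L"
  obtains c where "scales_lborel (\<lambda>x. w + L x) c"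
  using scales_compose[OF scales_translation scales_linear[OF assms]] by blast

lemma scales_emeasure:
  assumes "scales_lborel T c" and [measurable]: "A \<in> sets borel"
  shows "emeasure lborel (T -` A) = ennreal c * emeasure lborel A"
proof -
  note [measurable] = scales_measurable[OF assms(1)]
  have "emeasure lborel (T -` A) = emeasure (distr lborel borel T) A"
    by (simp add: emeasure_distr)
  then show ?thesis
    by (simp add: scales_distr[OF assms(1)] emeasure_density nn_integral_cmult)
qed

section \<open>Scaling constants of diagonal and of unipotent maps\<close>

text \<open>Some constant exists by \<open>scales_linear\<close>; it is read off from the unit cube,
  whose preimage is a box with side lengths \<open>inverse (p i)\<close>.\<close>

lemma scales_diagonal:
  fixes p :: "'n::finite \<Rightarrow> real"
  assumes p: "\<And>i. 0 < p i"
  shows "scales_lborel (\<lambda>x::real^'n. \<chi> i. p i * x $ i) (\<Prod>i\<in>UNIV. inverse (p i))"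
proof -
  let ?L = "\<lambda>x::real^'n. \<chi> i. p i * x $ i"
  have "linear ?L" by (rule linearI) (auto simp: vec_eq_iff algebra_simps)
  moreover have "inj ?L"
    using p by (auto simp: inj_def vec_eq_iff less_imp_neq[symmetric])
  ultimately obtain c where c: "scales_lborel ?L c"
    using scales_linear by blast
  have "?L -` cbox 0 1 = cbox 0 (\<chi> i. inverse (p i))"
  proof -
    have "0 \<le> p i * y \<longleftrightarrow> 0 \<le> y" "p i * y \<le> 1 \<longleftrightarrow> y \<le> inverse (p i)" for i y
      using p[of i] by (auto simp: zero_le_mult_iff field_simps)
    then show ?thesis by (auto simp: mem_box_cart)
  qed
  then have "emeasure lborel (cbox 0 (\<chi> i. inverse (p i)) :: (real^'n) set)
      = ennreal c * emeasure lborel (cbox 0 1 :: (real^'n) set)"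
    using scales_emeasure[OF c, of "cbox 0 1"] by simp
  moreover have "emeasure lborel (cbox 0 u :: (real^'n) set) = ennreal (\<Prod>i\<in>UNIV. u $ i)"
    if "\<And>i. 0 \<le> u $ i" for u
  proof -
    have "cbox 0 u \<noteq> {}" using that by (auto simp: interval_ne_empty_cart)
    then have "measure lborel (cbox 0 u) = (\<Prod>i\<in>UNIV. u $ i)"
      by (simp add: content_cbox_cart)
    then show ?thesis
      using emeasure_lborel_cbox_finite[of 0 u]
      by (subst emeasure_eq_ennreal_measure) (auto simp: less_top)
  qed
  ultimately have "ennreal (\<Prod>i\<in>UNIV. inverse (p i)) = ennreal c"
    using p by (simp add: less_imp_le)
  then have "(\<Prod>i\<in>UNIV. inverse (p i)) = c"
    using p scales_pos[OF c] by (subst (asm) ennreal_inj) (auto intro!: prod_pos less_imp_le)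
  then show ?thesis using c by simp
qed

text \<open>The preimage of the ball of radius 1 + \<delta> contains the unit ball, and that of the
  ball of radius 1 - \<delta> lies inside it. Comparing volumes squeezes c, so maps arbitrarily
  close to the identity that share one constant must have c = 1.\<close>

lemma scales_near_identity:
  fixes L :: "'a::euclidean_space \<Rightarrow> 'a"
  assumes "scales_lborel L c" and \<delta>: "0 \<le> \<delta>" "\<delta> < 1" and near: "\<And>x. norm (L x - x) \<le> \<delta> * norm x"
  shows "1 \<le> c * (1 + \<delta>) ^ DIM('a)" "c * (1 - \<delta>) ^ DIM('a) \<le> 1"
proof -
  define w where "w = measure lborel (ball (0::'a) 1)"
  have ball: "emeasure lborel (ball (0::'a) r) = ennreal (r ^ DIM('a) * w)" if "0 \<le> r" for r
    using that by (simp add: w_def emeasure_ball content_ball mult.commute)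
  have w: "0 < w"
    using emeasure_lborel_ball_nonzero[of 1 "0::'a"] ball[of 1] by (auto simp: ennreal_eq_0_iff not_le)
  have up: "norm (L x) \<le> (1 + \<delta>) * norm x" and low: "(1 - \<delta>) * norm x \<le> norm (L x)" for x
    using near[of x] norm_triangle_ineq2[of "L x" x] norm_triangle_ineq3[of "L x" x]
    by (auto simp: algebra_simps abs_le_iff)
  have c: "0 < c" using scales_pos[OF assms(1)] .
  have eq: "emeasure lborel (L -` ball 0 r) = ennreal (c * (r ^ DIM('a) * w))" if "0 \<le> r" for r
    using scales_emeasure[OF assms(1), of "ball 0 r"] c w that by (simp add: ball ennreal_mult)
  have meas: "L -` ball 0 r \<in> sets lborel" for r
    using measurable_sets[OF scales_measurable[OF assms(1)], of "ball 0 r"] by simp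
  have "ball 0 1 \<subseteq> L -` ball 0 (1 + \<delta>)"
  proof
    fix x :: 'a assume "x \<in> ball 0 1"
    then have "(1 + \<delta>) * norm x < (1 + \<delta>) * 1" using \<delta> by (intro mult_strict_left_mono) auto
    then show "x \<in> L -` ball 0 (1 + \<delta>)" using up[of x] by simp
  qed
  then have "emeasure lborel (ball (0::'a) 1) \<le> emeasure lborel (L -` ball 0 (1 + \<delta>))"
    by (intro emeasure_mono meas)
  then have "1 * w \<le> (c * (1 + \<delta>) ^ DIM('a)) * w"
    using \<delta> c w by (simp add: eq ball ennreal_le_iff mult.assoc)
  then show "1 \<le> c * (1 + \<delta>) ^ DIM('a)" using w by (rule mult_right_le_imp_le)
  have "L -` ball 0 (1 - \<delta>) \<subseteq> ball 0 1"
  proof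
    fix x assume "x \<in> L -` ball 0 (1 - \<delta>)"
    then have "(1 - \<delta>) * norm x < (1 - \<delta>) * 1" using low[of x] by simp
    then show "x \<in> ball 0 1" using \<delta> by (simp only: mult_less_cancel_left) auto
  qed
  then have "emeasure lborel (L -` ball 0 (1 - \<delta>)) \<le> emeasure lborel (ball (0::'a) 1)"
    by (intro emeasure_mono) auto
  then have "(c * (1 - \<delta>) ^ DIM('a)) * w \<le> 1 * w"
    using \<delta> c w by (simp add: eq ball ennreal_le_iff mult.assoc)
  then show "c * (1 - \<delta>) ^ DIM('a) \<le> 1" using w by (rule mult_right_le_imp_le)
qed

text \<open>Conjugating a unipotent matrix by \<open>diag(r\<^sup>0, r\<^sup>1, \<dots>)\<close> does not change its scaling constant
  and moves it to the identity as \<open>r \<rightarrow> 0\<close>.\<close>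

lemma scales_unipotent:
  fixes U :: "real ^ 'n::{finite,linorder} ^ 'n::{finite,linorder}"
  assumes U: "U \<in> unipotent_upper" and inj: "inj ((*v) U)"
  shows "scales_lborel ((*v) U) 1"
proof -
  obtain c where c: "scales_lborel ((*v) U) c"
    using scales_linear[OF matrix_vector_mul_linear inj] by blast
  \<comment> \<open>Counting smaller indices supplies the exponents 0, 1, ... of the conjugating
    diagonal matrix for an arbitrary finite linear order.\<close>
  define rk where "rk i = card {j::'n. j < i}" for i
  have rk: "rk i < rk j" if "i < j" for i j
    unfolding rk_def using that by (intro psubset_card_mono) auto
  define K where "K = (\<Sum>i\<in>UNIV. \<Sum>j\<in>UNIV. \<bar>U $ i $ j\<bar>)"
  have "0 \<le> K" unfolding K_def by (intro sum_nonneg) auto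
  \<comment> \<open>This is diag(r^rk)^(-1) U diag(r^rk): the entry at (i, j) is multiplied by r^(rk
    j - rk i), a positive power of r above the diagonal.\<close>
  define V where "V r x = (\<chi> i. inverse (r ^ rk i) * (U *v (\<chi> j. r ^ rk j * x $ j)) $ i)"
    for r and x :: "(real, 'n) vec"
  have V: "scales_lborel (V r) c" if "0 < r" for r
  proof -
    \<comment> \<open>The constants of the two diagonal factors are reciprocal, so conjugation
      leaves c unchanged.\<close>
    have 1: "scales_lborel (\<lambda>x::(real, 'n) vec. \<chi> i. r ^ rk i * x $ i) (\<Prod>i\<in>UNIV. inverse (r ^ rk i))"
      using that by (intro scales_diagonal) simp
    have 2: "scales_lborel (\<lambda>x::(real, 'n) vec. \<chi> i. inverse (r ^ rk i) * x $ i) (\<Prod>i\<in>UNIV. inverse (inverse (r ^ rk i)))"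
      using that by (intro scales_diagonal) simp
    have "(\<Prod>i\<in>UNIV. inverse (inverse (r ^ rk i))) * (c * (\<Prod>i\<in>UNIV. inverse (r ^ rk i)))
        = c * (\<Prod>i\<in>UNIV. inverse (inverse (r ^ rk i)) * inverse (r ^ rk i))"
      by (simp only: prod.distrib mult_ac)
    also have "\<dots> = c" using that by simp
    finally have eq: "(\<Prod>i\<in>UNIV. inverse (inverse (r ^ rk i))) * (c * (\<Prod>i\<in>UNIV. inverse (r ^ rk i))) = c" .
    show ?thesis
      using scales_compose[OF 2 scales_compose[OF c 1]] unfolding V_def eq .
  qed
  have near: "norm (V r x - x) \<le> r * K * norm x" if r: "0 < r" "r \<le> 1" for r x
  proof -
    have "\<bar>(V r x - x) $ i\<bar> \<le> (\<Sum>j\<in>UNIV. \<bar>U $ i $ j\<bar>) * (r * norm x)" for i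
    proof -
      have "(V r x - x) $ i = (\<Sum>j\<in>UNIV. (if j = i then 0 else U $ i $ j * (inverse (r ^ rk i) * r ^ rk j) * x $ j))"
      proof -
        define h where "h j = U $ i $ j * (inverse (r ^ rk i) * r ^ rk j) * x $ j" for j
        have "V r x $ i = (\<Sum>j\<in>UNIV. h j)"
          by (simp add: V_def h_def matrix_vector_mult_def sum_distrib_left mult_ac)
        also have "\<dots> = h i + (\<Sum>j\<in>UNIV - {i}. h j)" by (rule sum.remove) auto
        also have "h i = x $ i" using U r by (simp add: h_def unipotent_upper_def)
        also have "(\<Sum>j\<in>UNIV - {i}. h j) = (\<Sum>j\<in>UNIV. if j = i then 0 else h j)"
          by (intro sum.mono_neutral_cong_left) auto
        finally show ?thesis unfolding h_def by simp
      qed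
      also have "\<bar>\<dots>\<bar> \<le> (\<Sum>j\<in>UNIV. \<bar>U $ i $ j\<bar> * (r * norm x))"
      proof (rule order_trans[OF sum_abs sum_mono])
        fix j
        show "\<bar>if j = i then 0 else U $ i $ j * (inverse (r ^ rk i) * r ^ rk j) * x $ j\<bar>
            \<le> \<bar>U $ i $ j\<bar> * (r * norm x)"
        proof (cases "i < j")
          case True
          then have "rk i < rk j" by (rule rk)
          \<comment> \<open>The exponent difference is at least 1; one factor r is split off, and
            the remaining power is at most 1 because r \<le> 1.\<close>
          then have "r ^ rk j = r ^ rk i * (r * r ^ (rk j - rk i - 1))"
            by (simp flip: power_Suc power_add)
          then have "inverse (r ^ rk i) * r ^ rk j = r * r ^ (rk j - rk i - 1)" using r by simp
          also have "\<dots> \<le> r * 1" using r by (intro mult_left_mono power_le_one) auto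
          finally have *: "\<bar>inverse (r ^ rk i) * r ^ rk j\<bar> \<le> r" using r by simp
          have "\<bar>U $ i $ j\<bar> * (\<bar>inverse (r ^ rk i) * r ^ rk j\<bar> * \<bar>x $ j\<bar>) \<le> \<bar>U $ i $ j\<bar> * (r * norm x)"
            using r by (intro mult_left_mono mult_mono * component_le_norm_cart) auto
          then show ?thesis using r by (auto simp: abs_mult mult.assoc)
        next
          case False
          then have "j = i \<or> U $ i $ j = 0" using U by (auto simp: unipotent_upper_def not_less le_less)
          then show ?thesis using r by auto
        qed
      qed
      finally show ?thesis by (simp add: sum_distrib_right)
    qed
    then have "(\<Sum>i\<in>UNIV. \<bar>(V r x - x) $ i\<bar>) \<le> (\<Sum>i\<in>UNIV. (\<Sum>j\<in>UNIV. \<bar>U $ i $ j\<bar>) * (r * norm x))"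
      by (rule sum_mono)
    also have "\<dots> = r * K * norm x" unfolding K_def sum_distrib_right[symmetric] by (simp only: mult_ac)
    finally show ?thesis using norm_le_l1_cart[of "V r x - x"] by linarith
  qed
  \<comment> \<open>The bound r * K for the choice r = 1 / (n + 1).\<close>
  define \<delta> where "\<delta> n = K * (1 / real (Suc n))" for n
  have "\<delta> \<longlonglongrightarrow> K * 0"
    unfolding \<delta>_def by (intro tendsto_intros LIMSEQ_Suc[OF lim_1_over_n])
  then have \<delta>: "\<delta> \<longlonglongrightarrow> 0" by simp
  then have ev: "eventually (\<lambda>n. \<delta> n < 1) sequentially" by (rule order_tendstoD) simp
  let ?d = "DIM((real, 'n) vec)"
  have lim1: "(\<lambda>n. c * (1 + \<delta> n) ^ ?d) \<longlonglongrightarrow> c * (1 + 0) ^ ?d"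
    and lim2: "(\<lambda>n. c * (1 - \<delta> n) ^ ?d) \<longlonglongrightarrow> c * (1 - 0) ^ ?d"
    by (intro tendsto_intros \<delta>)+
  have bounds: "1 \<le> c * (1 + \<delta> n) ^ ?d \<and> c * (1 - \<delta> n) ^ ?d \<le> 1" if "\<delta> n < 1" for n
  proof -
    have "norm (V (1 / real (Suc n)) x - x) \<le> \<delta> n * norm x" for x
      using near[of "1 / real (Suc n)" x] by (simp add: \<delta>_def mult_ac)
    then show ?thesis
      using scales_near_identity[OF V[of "1 / real (Suc n)"] _ that] \<open>0 \<le> K\<close> by (simp add: \<delta>_def)
  qed
  have "1 \<le> c * (1 + 0) ^ ?d"
    by (rule tendsto_lowerbound[OF lim1 eventually_mono[OF ev]]) (auto dest: bounds)
  moreover have "c * (1 - 0) ^ ?d \<le> 1"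
    by (rule tendsto_upperbound[OF lim2 eventually_mono[OF ev]]) (auto dest: bounds)
  ultimately have "c = 1" by simp
  with c show ?thesis by simp
qed

section \<open>The Fourier transform and Gaussian regularisation\<close>

text \<open>Taking extended nonnegative values lets the inequalities be stated for functions not yet
  known to lie in \<open>L2\<close>; membership then amounts to finiteness.\<close>

definition L2_sq :: "('a::euclidean_space \<Rightarrow> complex) \<Rightarrow> ennreal"
  where "L2_sq f = (\<integral>\<^sup>+x. ennreal ((norm (f x))\<^sup>2) \<partial>lborel)"

lemma L2_tendsto_iff: "L2_tendsto \<phi> f \<longleftrightarrow> (\<lambda>n. L2_sq (\<lambda>x. \<phi> n x - f x)) \<longlonglongrightarrow> 0"
  by (simp add: L2_tendsto_def L2_sq_def)

lemma L2_iff: "f \<in> L2 \<longleftrightarrow> f \<in> borel_measurable borel \<and> L2_sq f < \<infinity>"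
  by (auto simp: L2_def L2_sq_def integrable_iff_bounded)

lemma L2_measurable: "f \<in> L2 \<Longrightarrow> f \<in> borel_measurable borel"
  by (simp add: L2_iff)

lemma L1_measurable: "f \<in> L1 \<Longrightarrow> f \<in> borel_measurable borel"
  by (auto simp: L1_def dest: borel_measurable_integrable)

lemma L2_sq_mono:
  assumes "\<And>x. norm (f x) \<le> norm (g x)"
  shows "L2_sq f \<le> L2_sq g"
  unfolding L2_sq_def by (intro nn_integral_mono) (simp add: assms)

lemma L2_sq_cong: "AE x in lborel. f x = g x \<Longrightarrow> L2_sq f = L2_sq g"
  unfolding L2_sq_def by (intro nn_integral_cong_AE) (auto elim!: eventually_mono)

text \<open>Optimising over \<open>\<delta>\<close> gives Minkowski's inequality, \<open>L2_norm_add\<close> below.\<close>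

lemma L2_sq_add_le:
  assumes [measurable]: "f \<in> borel_measurable borel" "g \<in> borel_measurable borel" and "0 < \<delta>"
  shows "L2_sq (\<lambda>x. f x + g x) \<le> ennreal (1 + \<delta>) * L2_sq f + ennreal (1 + 1 / \<delta>) * L2_sq g"
proof -
  have "(norm (f x + g x))\<^sup>2 \<le> (1 + \<delta>) * (norm (f x))\<^sup>2 + (1 + 1 / \<delta>) * (norm (g x))\<^sup>2" for x
  proof -
    have "(norm (f x + g x))\<^sup>2 \<le> (norm (f x) + norm (g x))\<^sup>2"
      by (intro power_mono norm_triangle_ineq) simp
    also have "\<dots> \<le> (1 + \<delta>) * (norm (f x))\<^sup>2 + (1 + 1 / \<delta>) * (norm (g x))\<^sup>2"
    proof -
      have "0 \<le> (\<delta> * norm (f x) - norm (g x))\<^sup>2 / \<delta>" using \<open>0 < \<delta>\<close> by simp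
      also have "\<dots> = \<delta> * (norm (f x))\<^sup>2 + (norm (g x))\<^sup>2 / \<delta> - 2 * norm (f x) * norm (g x)"
        using \<open>0 < \<delta>\<close> by (simp add: power2_eq_square field_simps)
      finally show ?thesis by (simp add: power2_eq_square algebra_simps)
    qed
    finally show ?thesis .
  qed
  then have "L2_sq (\<lambda>x. f x + g x)
      \<le> (\<integral>\<^sup>+x. ennreal ((1 + \<delta>) * (norm (f x))\<^sup>2 + (1 + 1 / \<delta>) * (norm (g x))\<^sup>2) \<partial>lborel)"
    unfolding L2_sq_def by (intro nn_integral_mono ennreal_leI)
  also have "\<dots> = (\<integral>\<^sup>+x. ennreal (1 + \<delta>) * ennreal ((norm (f x))\<^sup>2)
      + ennreal (1 + 1 / \<delta>) * ennreal ((norm (g x))\<^sup>2) \<partial>lborel)"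
    using \<open>0 < \<delta>\<close> by (intro nn_integral_cong) (simp add: ennreal_mult ennreal_plus)
  also have "\<dots> = ennreal (1 + \<delta>) * L2_sq f + ennreal (1 + 1 / \<delta>) * L2_sq g"
    by (simp add: L2_sq_def nn_integral_add nn_integral_cmult)
  finally show ?thesis .
qed

lemma L2_sq_add:
  assumes "f \<in> borel_measurable borel" "g \<in> borel_measurable borel"
  shows "L2_sq (\<lambda>x. f x + g x) \<le> 2 * L2_sq f + 2 * L2_sq g"
  using L2_sq_add_le[OF assms, of 1] by simp

lemma L2_sq_diff_commute: "L2_sq (\<lambda>x. f x - g x) = L2_sq (\<lambda>x. g x - f x)"
  by (simp add: L2_sq_def norm_minus_commute)

lemma L2_sq_cmult:
  assumes [measurable]: "f \<in> borel_measurable borel"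
  shows "L2_sq (\<lambda>x. c * f x) = ennreal ((norm c)\<^sup>2) * L2_sq f"
  by (simp add: L2_sq_def norm_mult power_mult_distrib ennreal_mult nn_integral_cmult)

lemma L2_sq_eq_0:
  assumes [measurable]: "f \<in> borel_measurable borel" and "L2_sq f = 0"
  shows "AE x in lborel. f x = 0"
  using assms(2) unfolding L2_sq_def by (subst (asm) nn_integral_0_iff_AE) auto

lemma L2_add: "f \<in> L2 \<Longrightarrow> g \<in> L2 \<Longrightarrow> (\<lambda>x. f x + g x) \<in> L2"
  using L2_sq_add[of f g]
  by (auto simp: L2_iff ennreal_mult_less_top less_top[symmetric] top_unique ennreal_mult_eq_top_iff)

lemma L2_cmult: "f \<in> L2 \<Longrightarrow> (\<lambda>x. c * f x) \<in> L2"
  by (auto simp: L2_iff L2_sq_cmult ennreal_mult_less_top)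

lemma L2_diff: "f \<in> L2 \<Longrightarrow> g \<in> L2 \<Longrightarrow> (\<lambda>x. f x - g x) \<in> L2"
  using L2_add[of f "\<lambda>x. (-1) * g x"] L2_cmult[of g "-1"] by simp

lemma L2_bound:
  assumes "g \<in> L2" "f \<in> borel_measurable borel" "\<And>x. norm (f x) \<le> norm (g x)"
  shows "f \<in> L2"
  using assms L2_sq_mono[of f g, OF assms(3)] by (auto simp: L2_iff intro: le_less_trans)

lemma L1_add: "f \<in> L1 \<Longrightarrow> g \<in> L1 \<Longrightarrow> (\<lambda>x. f x + g x) \<in> L1"
  by (simp add: L1_def)

lemma L1_diff: "f \<in> L1 \<Longrightarrow> g \<in> L1 \<Longrightarrow> (\<lambda>x. f x - g x) \<in> L1"
  by (simp add: L1_def)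

lemma L1_cmult: "f \<in> L1 \<Longrightarrow> (\<lambda>x. c * f x) \<in> L1"
  by (simp add: L1_def)

lemma L2_sq_scales:
  assumes "scales_lborel T c" and [measurable]: "f \<in> borel_measurable borel"
  shows "L2_sq (\<lambda>x. f (T x)) = ennreal c * L2_sq f"
  unfolding L2_sq_def using scales_nn_integral[OF assms(1), of "\<lambda>x. ennreal ((norm (f x))\<^sup>2)"] by simp

lemma L2_scales:
  assumes "scales_lborel T c" "f \<in> L2"
  shows "(\<lambda>x. f (T x)) \<in> L2"
  using assms(2) scales_measurable[OF assms(1)] L2_sq_scales[OF assms(1), of f]
  by (auto simp: L2_iff ennreal_mult_less_top)

lemma L1_scales:
  assumes "scales_lborel T c" "f \<in> L1"
  shows "(\<lambda>x. f (T x)) \<in> L1"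
  using assms scales_integrable[OF assms(1)] by (simp add: L1_def)

text \<open>If \<open>f\<close> is not integrable, its Bochner integral is 0 by convention and the
  left side vanishes.\<close>

lemma ennreal_norm_integral_le:
  fixes f :: "'a \<Rightarrow> 'b::{banach, second_countable_topology}"
  shows "ennreal (norm (integral\<^sup>L M f)) \<le> (\<integral>\<^sup>+x. ennreal (norm (f x)) \<partial>M)"
  by (cases "integrable M f") (auto simp: integral_norm_bound_ennreal not_integrable_integral_eq)

section \<open>The character exp(-2 pi i t) and the Fourier integral\<close>

definition wave :: "real \<Rightarrow> complex"
  where "wave t = exp (- 2 * of_real pi * \<i> * of_real t)"

lemma norm_wave [simp]: "norm (wave t) = 1"
  by (simp add: wave_def norm_exp_eq_Re)

lemma wave_0 [simp]: "wave 0 = 1"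
  by (simp add: wave_def)

lemma wave_add: "wave (s + t) = wave s * wave t"
  unfolding wave_def exp_add[symmetric] by (simp add: algebra_simps)

lemma cnj_wave: "cnj (wave t) = wave (- t)"
  by (simp add: wave_def exp_cnj)

lemma continuous_on_wave: "continuous_on A wave"
  unfolding wave_def by (intro continuous_intros)

lemma borel_measurable_wave [measurable]: "wave \<in> borel_measurable borel"
  by (intro borel_measurable_continuous_onI continuous_on_wave)

lemma borel_measurable_cnj [measurable]: "cnj \<in> borel_measurable borel"
  by (intro borel_measurable_continuous_onI continuous_intros)

lemma fourier_wave: "fourier f \<xi> = (LINT x|lborel. f x * wave (\<xi> \<bullet> x))"
  by (simp add: fourier_def wave_def)

lemma L1_mult_wave:
  assumes "f \<in> L1" and [measurable]: "g \<in> borel_measurable borel"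
  shows "(\<lambda>x. f x * wave (g x)) \<in> L1"
proof -
  note [measurable] = L1_measurable[OF assms(1)]
  show ?thesis using assms(1) unfolding L1_def mem_Collect_eq
    by (rule Bochner_Integration.integrable_bound) (auto simp: norm_mult)
qed

lemma integrable_fourier:
  assumes "f \<in> L1"
  shows "integrable lborel (\<lambda>x. f x * wave (\<xi> \<bullet> x))"
  using L1_mult_wave[OF assms, of "\<lambda>x. \<xi> \<bullet> x"] by (simp add: L1_def)

lemma fourier_add:
  assumes "f \<in> L1" "g \<in> L1"
  shows "fourier (\<lambda>x. f x + g x) \<xi> = fourier f \<xi> + fourier g \<xi>"
  using integrable_fourier[OF assms(1)] integrable_fourier[OF assms(2)]
  by (simp add: fourier_wave distrib_right)

lemma fourier_diff:
  assumes "f \<in> L1" "g \<in> L1"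
  shows "fourier (\<lambda>x. f x - g x) \<xi> = fourier f \<xi> - fourier g \<xi>"
  using integrable_fourier[OF assms(1)] integrable_fourier[OF assms(2)]
  by (simp add: fourier_wave left_diff_distrib)

lemma fourier_cmult: "fourier (\<lambda>x. c * f x) \<xi> = c * fourier f \<xi>"
  by (simp add: fourier_wave mult.assoc)

lemma fourier_measurable:
  assumes [measurable]: "f \<in> borel_measurable borel"
  shows "fourier f \<in> borel_measurable borel"
  unfolding fourier_wave[abs_def] by measurable

lemma norm_fourier_le:
  "norm (fourier f \<xi>) \<le> (LINT x|lborel. norm (f x))"
  unfolding fourier_wave
  by (rule order_trans[OF integral_norm_bound]) (simp add: norm_mult)

text \<open>The last hypothesis says that \<eta> is the image of \<xi> under the adjoint inverse of
  the linear part of \<open>T\<close>, and w is the translation part. Phrasing it as an identity of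
  inner products avoids naming the linear part or inverting it.\<close>

lemma fourier_scales:
  assumes "scales_lborel T c" and [measurable]: "f \<in> borel_measurable borel"
    and "\<And>x. \<eta> \<bullet> (T x - w) = \<xi> \<bullet> x"
  shows "fourier (\<lambda>x. f (T x)) \<xi> = of_real c * wave (- (\<eta> \<bullet> w)) * fourier f \<eta>"
proof -
  have "fourier (\<lambda>x. f (T x)) \<xi> = (LINT x|lborel. (\<lambda>y. f y * wave (\<eta> \<bullet> (y - w))) (T x))"
    by (simp add: fourier_wave assms(3))
  also have "\<dots> = c *\<^sub>R (LINT y|lborel. f y * wave (\<eta> \<bullet> (y - w)))"
    by (rule scales_integral[OF assms(1)]) simp
  also have "(LINT y|lborel. f y * wave (\<eta> \<bullet> (y - w)))
      = (LINT y|lborel. wave (- (\<eta> \<bullet> w)) * (f y * wave (\<eta> \<bullet> y)))"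
    by (intro Bochner_Integration.integral_cong)
      (auto simp: inner_diff_right wave_add[of _ "- _", simplified] mult_ac)
  finally show ?thesis by (simp add: fourier_wave scaleR_conv_of_real)
qed

text \<open>Fubini for a kernel that is symmetric in x and \<xi> and has modulus 1, so that absolute
  integrability reduces to that of f(x) g(\<xi>).\<close>

lemma fourier_multiplication_formula:
  assumes "f \<in> L1" "g \<in> L1"
  shows "(LINT \<xi>|lborel. fourier f \<xi> * g \<xi>) = (LINT x|lborel. f x * fourier g x)"
proof -
  note [measurable] = assms[THEN L1_measurable]
  have f: "integrable lborel f" and g: "integrable lborel g" using assms by (auto simp: L1_def)
  define F where "F x \<xi> = f x * g \<xi> * wave (\<xi> \<bullet> x)" for x \<xi>
  have [measurable]: "case_prod F \<in> borel_measurable (borel \<Otimes>\<^sub>M borel)"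
    unfolding F_def by measurable
  have nF: "norm (F x \<xi>) = norm (f x) * norm (g \<xi>)" for x \<xi>
    by (simp add: F_def norm_mult)
  have "integrable (lborel \<Otimes>\<^sub>M lborel) (case_prod F)"
  proof (rule lborel_pair.Fubini_integrable)
    show "integrable lborel (\<lambda>x. LINT y|lborel. norm (case_prod F (x, y)))"
      using f by (simp add: nF)
    show "AE x in lborel. integrable lborel (\<lambda>y. case_prod F (x, y))"
    proof (rule AE_I2)
      fix x
      have "integrable lborel (\<lambda>y. f x * g y)" using g by simp
      then show "integrable lborel (\<lambda>y. case_prod F (x, y))"
        by (rule Bochner_Integration.integrable_bound) (auto simp: nF norm_mult)
    qed
  qed simp
  then have "(LINT \<xi>|lborel. LINT x|lborel. F x \<xi>) = (LINT x|lborel. LINT \<xi>|lborel. F x \<xi>)"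
    by (rule lborel_pair.Fubini_integral)
  moreover have "(LINT x|lborel. F x \<xi>) = fourier f \<xi> * g \<xi>" for \<xi>
  proof -
    have "(LINT x|lborel. F x \<xi>) = (LINT x|lborel. (f x * wave (\<xi> \<bullet> x)) * g \<xi>)"
      by (simp add: F_def mult_ac)
    then show ?thesis by (simp add: fourier_wave)
  qed
  moreover have "(LINT \<xi>|lborel. F x \<xi>) = f x * fourier g x" for x
    by (simp add: F_def fourier_wave mult.assoc inner_commute)
  ultimately show ?thesis by simp
qed

section \<open>Gaussians and Gaussian regularisation\<close>

text \<open>The factor pi is the normalisation for which the Gaussian has integral 1 and, with the
  kernel exp(-2 pi i t), is its own Fourier transform.\<close>

definition gauss :: "'a::euclidean_space \<Rightarrow> real"
  where "gauss x = exp (- pi * (norm x)\<^sup>2)"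

lemma gauss_pos [simp]: "0 < gauss x" and gauss_nonneg [simp]: "0 \<le> gauss x"
  and gauss_le_1: "gauss x \<le> 1"
  by (simp_all add: gauss_def)

lemma continuous_on_gauss: "continuous_on A gauss"
  unfolding gauss_def by (intro continuous_intros)

lemma borel_measurable_gauss [measurable]: "gauss \<in> borel_measurable borel"
  by (intro borel_measurable_continuous_onI continuous_on_gauss)

lemma fourier_gauss_real:
  fixes t :: real
  shows "integrable lborel (\<lambda>x. complex_of_real (exp (- pi * x\<^sup>2)) * wave (t * x))"
    and "(LINT x|lborel. complex_of_real (exp (- pi * x\<^sup>2)) * wave (t * x)) = exp (- pi * t\<^sup>2)"
proof -
  \<comment> \<open>Rescaling by s turns the standard normal density into the Gaussian divided by s,
    so the integral becomes a characteristic function.\<close>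
  define s where "s = sqrt (2 * pi)"
  have s: "0 < s" "s\<^sup>2 = 2 * pi" by (simp_all add: s_def)
  have dens: "std_normal_density (s * x) = exp (- pi * x\<^sup>2) / s" for x
    by (simp add: std_normal_density_def power_mult_distrib s s_def[symmetric])
  have "integrable lborel (\<lambda>x. std_normal_density (0 + s * x))"
    using s by (intro lborel_integrable_real_affine integrable_normal_density) auto
  then have "integrable lborel (\<lambda>x. s * std_normal_density (0 + s * x))"
    by (rule integrable_mult_right)
  then have "integrable lborel (\<lambda>x. exp (- pi * x\<^sup>2))"
    using s by (simp add: dens)
  then show "integrable lborel (\<lambda>x. complex_of_real (exp (- pi * x\<^sup>2)) * wave (t * x))"
    by (rule Bochner_Integration.integrable_bound) (auto simp: norm_mult)
  \<comment> \<open>Chosen so that r s x = -2 pi t x; then r^2 / 2 = pi t^2, the exponent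
    required.\<close>
  define r where "r = - 2 * pi * t / s"
  have "complex_of_real (exp (- r\<^sup>2 / 2)) = (CLINT x|std_normal_distribution. iexp (r * x))"
    using char_std_normal_distribution by (simp add: char_def fun_eq_iff)
  also have "\<dots> = (LINT x|lborel. std_normal_density x *\<^sub>R iexp (r * x))"
    by (subst integral_density) auto
  also have "\<dots> = \<bar>s\<bar> *\<^sub>R (LINT x|lborel. std_normal_density (0 + s * x) *\<^sub>R iexp (r * (0 + s * x)))"
    using s by (intro lborel_integral_real_affine) auto
  also have "\<dots> = (LINT x|lborel. s *\<^sub>R (std_normal_density (0 + s * x) *\<^sub>R iexp (r * (0 + s * x))))"
    using s by (simp only: integral_scaleR_right abs_of_pos)
  also have "\<dots> = (LINT x|lborel. complex_of_real (exp (- pi * x\<^sup>2)) * wave (t * x))"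
  proof (intro Bochner_Integration.integral_cong refl)
    fix x
    have rs: "r * (0 + s * x) = - 2 * pi * (t * x)" using s by (simp add: r_def)
    have "iexp (r * (0 + s * x)) = wave (t * x)"
      unfolding rs by (simp add: wave_def mult_ac)
    then show "s *\<^sub>R (std_normal_density (0 + s * x) *\<^sub>R iexp (r * (0 + s * x)))
        = complex_of_real (exp (- pi * x\<^sup>2)) * wave (t * x)"
      using s by (simp add: dens scaleR_conv_of_real)
  qed
  finally show "(LINT x|lborel. complex_of_real (exp (- pi * x\<^sup>2)) * wave (t * x)) = exp (- pi * t\<^sup>2)"
    using s by (simp add: r_def power_divide power_mult_distrib) (simp add: power2_eq_square)
qed

text \<open>\<open>lborel\<close> is the image of the product of one-dimensional measures over
  \<open>Basis\<close>, and under this map the integrand becomes a product of functions of separate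
  coordinates.\<close>

lemma lborel_integral_prod_Basis:
  fixes f :: "'a::euclidean_space \<Rightarrow> real \<Rightarrow> complex"
  assumes f: "\<And>b. b \<in> Basis \<Longrightarrow> integrable lborel (f b)"
  shows "integrable lborel (\<lambda>x::'a. \<Prod>b\<in>Basis. f b (x \<bullet> b))"
    and "(LINT x::'a|lborel. (\<Prod>b\<in>Basis. f b (x \<bullet> b))) = (\<Prod>b\<in>Basis. LINT x|lborel. f b x)"
proof -
  interpret product_sigma_finite "\<lambda>_::'a. lborel :: real measure" ..
  have [measurable]: "f b \<in> borel_measurable borel" if "b \<in> Basis" for b
    using borel_measurable_integrable[OF f[OF that]] by simp
  define T where "T g = (\<Sum>b\<in>Basis. g b *\<^sub>R b)" for g :: "'a \<Rightarrow> real"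
  have [measurable]: "T \<in> (\<Pi>\<^sub>M b\<in>Basis. lborel) \<rightarrow>\<^sub>M borel" unfolding T_def by measurable
  have eq: "(\<Prod>b\<in>Basis. f b (T g \<bullet> b)) = (\<Prod>b\<in>Basis. f b (g b))" for g
    unfolding T_def by (intro prod.cong refl arg_cong2[where f=f] inner_sum_left_Basis)
  have *: "lborel = distr (\<Pi>\<^sub>M b\<in>Basis. lborel) borel T"
    unfolding T_def by (rule lborel_eq)
  have "integrable (\<Pi>\<^sub>M b\<in>Basis. lborel) (\<lambda>g. \<Prod>b\<in>Basis. f b (g b))"
    by (rule product_integrable_prod) (auto intro: f)
  then show "integrable lborel (\<lambda>x::'a. \<Prod>b\<in>Basis. f b (x \<bullet> b))"
    by (subst *, subst integrable_distr_eq) (auto simp: eq)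
  have "(LINT g|Pi\<^sub>M Basis (\<lambda>_. lborel). (\<Prod>b\<in>Basis. f b (g b))) = (\<Prod>b\<in>Basis. LINT x|lborel. f b x)"
    by (rule product_integral_prod) (auto intro: f)
  then show "(LINT x::'a|lborel. (\<Prod>b\<in>Basis. f b (x \<bullet> b))) = (\<Prod>b\<in>Basis. LINT x|lborel. f b x)"
    by (subst *, subst integral_distr) (auto simp: eq)
qed

lemma norm_sq_Basis: "(norm (x::'a::euclidean_space))\<^sup>2 = (\<Sum>b\<in>Basis. (x \<bullet> b)\<^sup>2)"
  unfolding power2_norm_eq_inner by (subst euclidean_inner) (simp add: power2_eq_square)

text \<open>The Gaussian and the character both factor over the coordinates, which reduces both
  claims to dimension one. Integrability is the case of frequency 0, where the character is
  1.\<close>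

lemma
  fixes \<xi> :: "'a::euclidean_space"
  shows integrable_gauss: "integrable lborel (gauss :: 'a \<Rightarrow> real)"
    and fourier_gauss: "fourier (\<lambda>x. of_real (gauss x)) \<xi> = of_real (gauss \<xi>)"
proof -
  define f where "f \<xi> = (\<lambda>(b::'a) x. complex_of_real (exp (- pi * x\<^sup>2)) * wave ((\<xi> \<bullet> b) * x))" for \<xi>
  have wave_sum: "wave (\<Sum>b\<in>A. h b) = (\<Prod>b\<in>A. wave (h b))" if "finite A" for A and h :: "'a \<Rightarrow> real"
    using that by induction (simp_all add: wave_add)
  have eq: "(\<Prod>b\<in>Basis. f \<xi> b (x \<bullet> b)) = of_real (gauss x) * wave (\<xi> \<bullet> x)" for x \<xi>
    by (subst euclidean_inner)
      (simp add: f_def prod.distrib wave_sum gauss_def norm_sq_Basis exp_sum sum_distrib_left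
        sum_negf[symmetric] flip: of_real_prod)
  have int: "integrable lborel (f \<xi> b)" for b \<xi>
    unfolding f_def by (rule fourier_gauss_real)
  have "integrable lborel (\<lambda>x. complex_of_real (gauss x) * wave ((0::'a) \<bullet> x))"
    using lborel_integral_prod_Basis(1)[of "f 0", OF int] by (simp only: eq)
  then show "integrable lborel (gauss :: 'a \<Rightarrow> real)" by (simp add: complex_of_real_integrable_eq)
  have "fourier (\<lambda>x. of_real (gauss x)) \<xi> = (\<Prod>b\<in>Basis. of_real (exp (- pi * (\<xi> \<bullet> b)\<^sup>2)))"
    unfolding fourier_wave
    using lborel_integral_prod_Basis(2)[of "f \<xi>", OF int]
    unfolding eq unfolding f_def fourier_gauss_real(2) .
  then show "fourier (\<lambda>x. of_real (gauss x)) \<xi> = of_real (gauss \<xi>)"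
    by (simp add: gauss_def norm_sq_Basis exp_sum sum_distrib_left sum_negf[symmetric] flip: of_real_prod)
qed

lemma integral_gauss: "(LINT x|lborel. gauss (x::'a::euclidean_space)) = 1"
proof -
  have "complex_of_real (LINT x|lborel. gauss (x::'a)) = fourier (\<lambda>x. of_real (gauss x)) (0::'a)"
    by (simp add: fourier_wave)
  then have "complex_of_real (LINT x|lborel. gauss (x::'a)) = of_real 1"
    unfolding fourier_gauss by (simp add: gauss_def)
  then show ?thesis by (simp only: of_real_eq_iff)
qed

lemma nn_integral_gauss: "(\<integral>\<^sup>+x. ennreal (gauss (x::'a::euclidean_space)) \<partial>lborel) = 1"
  by (simp add: nn_integral_eq_integral[OF integrable_gauss] integral_gauss)

lemma L1_gauss_scaled:
  assumes "\<epsilon> \<noteq> 0"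
  shows "(\<lambda>x::'a::euclidean_space. complex_of_real (gauss (\<epsilon> *\<^sub>R x))) \<in> L1"
  using L1_scales[OF scales_affine[OF assms, of 0], of "\<lambda>x. complex_of_real (gauss x)"]
    by (simp add: L1_def complex_of_real_integrable_eq integrable_gauss)

lemma fourier_gauss_scaled:
  fixes y :: "'a::euclidean_space"
  assumes "0 < \<epsilon>"
  shows "fourier (\<lambda>x::'a. of_real (gauss (\<epsilon> *\<^sub>R x))) y
    = of_real (inverse (\<epsilon> ^ DIM('a)) * gauss (y /\<^sub>R \<epsilon>))"
proof -
  have "fourier (\<lambda>x::'a. of_real (gauss (0 + \<epsilon> *\<^sub>R x))) y
      = of_real (inverse (\<bar>\<epsilon>\<bar> ^ DIM('a))) * wave (- ((y /\<^sub>R \<epsilon>) \<bullet> 0))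
        * fourier (\<lambda>x. of_real (gauss x)) (y /\<^sub>R \<epsilon>)"
    using assms by (intro fourier_scales[OF scales_affine]) auto
  then show ?thesis using assms by (simp add: fourier_gauss)
qed

lemma gauss_scaled_tendsto:
  "(\<lambda>n. gauss ((1 / real (Suc n)) *\<^sub>R \<xi>)) \<longlonglongrightarrow> 1"
proof -
  have "(\<lambda>n. gauss ((1 / real (Suc n)) *\<^sub>R \<xi>)) \<longlonglongrightarrow> exp (- pi * (norm (0 *\<^sub>R \<xi>))\<^sup>2)"
    unfolding gauss_def by (intro tendsto_intros LIMSEQ_Suc[OF lim_1_over_n])
  then show ?thesis by simp
qed

text \<open>Gaussian regularisation turns \<open>\<parallel>\<F> f\<parallel>\<^sup>2\<close> into \<open>\<langle>f, f * \<gamma>\<^sub>\<epsilon>\<rangle>\<close> for an approximate identity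
  \<open>\<gamma>\<^sub>\<epsilon>\<close>; the multiplication formula is used twice.\<close>

lemma fourier_gauss_regularised:
  fixes f :: "'a::euclidean_space \<Rightarrow> complex"
  assumes f: "f \<in> L1" and \<epsilon>: "0 < \<epsilon>"
  shows "integrable lborel (\<lambda>\<xi>. (norm (fourier f \<xi>))\<^sup>2 * gauss (\<epsilon> *\<^sub>R \<xi>))"
    and "complex_of_real (LINT \<xi>|lborel. (norm (fourier f \<xi>))\<^sup>2 * gauss (\<epsilon> *\<^sub>R \<xi>))
      = (LINT x|lborel. f x * cnj (LINT u|lborel. f (x + \<epsilon> *\<^sub>R u) * of_real (gauss u)))"
proof -
  note [measurable] = L1_measurable[OF f] fourier_measurable[OF L1_measurable[OF f]]
  define C where "C = (LINT x|lborel. norm (f x))"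
  have C: "norm (fourier f \<xi>) \<le> C" for \<xi> by (simp add: C_def norm_fourier_le)
  have "0 \<le> C" using C[of 0] norm_ge_zero order_trans by blast
  have g: "integrable lborel (\<lambda>\<xi>::'a. gauss (\<epsilon> *\<^sub>R \<xi>))"
    using L1_gauss_scaled[of \<epsilon>] \<epsilon> by (simp add: L1_def complex_of_real_integrable_eq)
  have "integrable lborel (\<lambda>\<xi>::'a. C\<^sup>2 * gauss (\<epsilon> *\<^sub>R \<xi>))" using g by simp
  then show "integrable lborel (\<lambda>\<xi>. (norm (fourier f \<xi>))\<^sup>2 * gauss (\<epsilon> *\<^sub>R \<xi>))"
    by (rule Bochner_Integration.integrable_bound)
      (auto simp: abs_mult intro!: mult_right_mono power_mono C)
  \<comment> \<open>Multiplying the transform of f by this function gives its squared modulus times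
    the Gaussian, so the first use of the multiplication formula moves the transform onto
    \<open>h\<close>.\<close>
  define h where "h \<xi> = cnj (fourier f \<xi>) * of_real (gauss (\<epsilon> *\<^sub>R \<xi>))" for \<xi>
  have [measurable]: "h \<in> borel_measurable borel" unfolding h_def by measurable
  have "h \<in> L1"
  proof -
    have "integrable lborel (\<lambda>\<xi>::'a. C * gauss (\<epsilon> *\<^sub>R \<xi>))" using g by simp
    then show ?thesis unfolding L1_def mem_Collect_eq
      by (rule Bochner_Integration.integrable_bound)
        (use \<open>0 \<le> C\<close> in \<open>auto simp: h_def norm_mult abs_mult intro!: mult_right_mono C\<close>)
  qed
  have fh: "fourier h x = cnj (LINT u|lborel. f (x + \<epsilon> *\<^sub>R u) * of_real (gauss u))" for x
  proof -
    \<comment> \<open>A modulated Gaussian, whose transform is a Gaussian of width \<epsilon>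
      centred at x. Since \<open>h\<close> paired with the character is the conjugate of
      \<open>fourier f\<close> times \<open>p\<close>, the multiplication formula applies a second
      time.\<close>
    define p where "p \<xi> = of_real (gauss (\<epsilon> *\<^sub>R \<xi>)) * wave (- (x \<bullet> \<xi>))" for \<xi>
    have p: "p \<in> L1"
      unfolding p_def using \<epsilon> by (intro L1_mult_wave L1_gauss_scaled) auto
    have fp: "fourier p y = of_real (inverse (\<epsilon> ^ DIM('a)) * gauss ((y - x) /\<^sub>R \<epsilon>))" for y
    proof -
      have "fourier p y = fourier (\<lambda>\<xi>. of_real (gauss (\<epsilon> *\<^sub>R \<xi>))) (y - x)"
        unfolding fourier_wave p_def
        by (intro Bochner_Integration.integral_cong)
          (auto simp: inner_diff_left mult_ac simp flip: wave_add)
      then show ?thesis using \<epsilon> by (simp add: fourier_gauss_scaled)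
    qed
    have "fourier h x = (LINT \<xi>|lborel. cnj (fourier f \<xi> * p \<xi>))"
      unfolding fourier_wave[of h]
      by (intro Bochner_Integration.integral_cong) (auto simp: h_def p_def cnj_wave mult_ac)
    also have "\<dots> = cnj (LINT y|lborel. f y * fourier p y)"
      by (simp only: Bochner_Integration.integral_cnj fourier_multiplication_formula[OF f p])
    also have "(LINT y|lborel. f y * fourier p y)
        = inverse (\<bar>\<epsilon>\<bar> ^ DIM('a)) *\<^sub>R (LINT y|lborel. f y * of_real (gauss ((y - x) /\<^sub>R \<epsilon>)))"
      using \<epsilon>
      by (subst integral_scaleR_right[symmetric])
        (auto simp: fp scaleR_conv_of_real mult_ac intro!: Bochner_Integration.integral_cong)
    also have "\<dots> = (LINT u|lborel. (\<lambda>y. f y * of_real (gauss ((y - x) /\<^sub>R \<epsilon>))) (x + \<epsilon> *\<^sub>R u))"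
      using \<epsilon> by (intro scales_integral[symmetric] scales_affine) auto
    finally show ?thesis using \<epsilon> by simp
  qed
  have "complex_of_real (LINT \<xi>|lborel. (norm (fourier f \<xi>))\<^sup>2 * gauss (\<epsilon> *\<^sub>R \<xi>))
      = (LINT \<xi>|lborel. complex_of_real ((norm (fourier f \<xi>))\<^sup>2 * gauss (\<epsilon> *\<^sub>R \<xi>)))"
    by (rule integral_complex_of_real[symmetric])
  also have "\<dots> = (LINT \<xi>|lborel. fourier f \<xi> * h \<xi>)"
    by (intro Bochner_Integration.integral_cong)
      (auto simp: h_def complex_norm_square simp del: of_real_power)
  also have "\<dots> = (LINT x|lborel. f x * fourier h x)"
    by (rule fourier_multiplication_formula[OF f \<open>h \<in> L1\<close>])
  finally show "complex_of_real (LINT \<xi>|lborel. (norm (fourier f \<xi>))\<^sup>2 * gauss (\<epsilon> *\<^sub>R \<xi>))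
      = (LINT x|lborel. f x * cnj (LINT u|lborel. f (x + \<epsilon> *\<^sub>R u) * of_real (gauss u)))"
    by (simp only: fh)
qed

text \<open>The Cauchy-Schwarz inequality is replaced by 2ab \<le> a^2 + b^2 under the integral: by
  translation invariance each of the two squares integrates to \<open>L2_sq f\<close>, and the
  Gaussian weight has total mass 1.\<close>

lemma fourier_gauss_regularised_le:
  fixes f :: "'a::euclidean_space \<Rightarrow> complex"
  assumes f: "f \<in> L1" and \<epsilon>: "0 < \<epsilon>"
  shows "ennreal (LINT \<xi>|lborel. (norm (fourier f \<xi>))\<^sup>2 * gauss (\<epsilon> *\<^sub>R \<xi>)) \<le> L2_sq f"
proof -
  note [measurable] = L1_measurable[OF f]
  define q where "q x = ennreal ((norm (f x))\<^sup>2)" for x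
  have [measurable]: "q \<in> borel_measurable borel" unfolding q_def by measurable
  have q: "(\<integral>\<^sup>+x. q x \<partial>lborel) = L2_sq f" by (simp add: q_def L2_sq_def)
  have shift: "(\<integral>\<^sup>+x. q (x + \<epsilon> *\<^sub>R u) \<partial>lborel) = L2_sq f" for u
    using scales_nn_integral[OF scales_translation[of "\<epsilon> *\<^sub>R u"], of q]
    by (simp add: q add.commute)
  let ?r = "LINT \<xi>|lborel. (norm (fourier f \<xi>))\<^sup>2 * gauss (\<epsilon> *\<^sub>R \<xi>)"
  let ?c = "\<lambda>x. LINT u|lborel. f (x + \<epsilon> *\<^sub>R u) * of_real (gauss u)"
  have "ennreal ?r \<le> ennreal (norm (complex_of_real ?r))"
    by (intro ennreal_leI) simp
  also have "\<dots> = ennreal (norm (LINT x|lborel. f x * cnj (?c x)))"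
    by (simp only: fourier_gauss_regularised(2)[OF f \<epsilon>])
  also have "\<dots> \<le> (\<integral>\<^sup>+x. ennreal (norm (f x * cnj (?c x))) \<partial>lborel)"
    by (rule ennreal_norm_integral_le)
  also have "\<dots> \<le> (\<integral>\<^sup>+x. \<integral>\<^sup>+u. (q x + q (x + \<epsilon> *\<^sub>R u)) * ennreal (gauss u / 2) \<partial>lborel \<partial>lborel)"
  proof (rule nn_integral_mono)
    fix x
    have "ennreal (norm (f x * cnj (?c x))) = ennreal (norm (f x)) * ennreal (norm (?c x))"
      by (simp add: norm_mult ennreal_mult)
    also have "\<dots> \<le> ennreal (norm (f x)) * (\<integral>\<^sup>+u. ennreal (norm (f (x + \<epsilon> *\<^sub>R u) * of_real (gauss u))) \<partial>lborel)"
      by (intro mult_left_mono ennreal_norm_integral_le) simp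
    also have "\<dots> = (\<integral>\<^sup>+u. ennreal (norm (f x) * norm (f (x + \<epsilon> *\<^sub>R u)) * gauss u) \<partial>lborel)"
      by (subst nn_integral_cmult[symmetric]) (auto simp: norm_mult ennreal_mult mult.assoc)
    also have "\<dots> \<le> (\<integral>\<^sup>+u. (q x + q (x + \<epsilon> *\<^sub>R u)) * ennreal (gauss u / 2) \<partial>lborel)"
    proof (rule nn_integral_mono)
      fix u
      let ?a = "norm (f x)" and ?b = "norm (f (x + \<epsilon> *\<^sub>R u))"
      have "2 * ?a * ?b \<le> ?a\<^sup>2 + ?b\<^sup>2" using sum_squares_bound[of ?a ?b] by simp
      then have "2 * ?a * ?b * (gauss u / 2) \<le> (?a\<^sup>2 + ?b\<^sup>2) * (gauss u / 2)"
        by (rule mult_right_mono) simp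
      then have "ennreal (?a * ?b * gauss u) \<le> ennreal ((?a\<^sup>2 + ?b\<^sup>2) * (gauss u / 2))"
        by (intro ennreal_leI) simp
      also have "\<dots> = (q x + q (x + \<epsilon> *\<^sub>R u)) * ennreal (gauss u / 2)"
        unfolding q_def by (subst ennreal_mult) (auto simp: ennreal_plus simp del: ennreal_half)
      finally show "ennreal (?a * ?b * gauss u) \<le> (q x + q (x + \<epsilon> *\<^sub>R u)) * ennreal (gauss u / 2)" .
    qed
    finally show "ennreal (norm (f x * cnj (?c x)))
        \<le> (\<integral>\<^sup>+u. (q x + q (x + \<epsilon> *\<^sub>R u)) * ennreal (gauss u / 2) \<partial>lborel)" .
  qed
  also have "\<dots> = (\<integral>\<^sup>+u. \<integral>\<^sup>+x. (q x + q (x + \<epsilon> *\<^sub>R u)) * ennreal (gauss u / 2) \<partial>lborel \<partial>lborel)"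
    by (rule lborel_pair.Fubini') measurable
  also have "\<dots> = (\<integral>\<^sup>+u. (L2_sq f + L2_sq f) * ennreal (gauss (u::'a) / 2) \<partial>lborel)"
    by (intro nn_integral_cong) (simp add: nn_integral_multc nn_integral_add q shift)
  also have "\<dots> = (\<integral>\<^sup>+u. L2_sq f * ennreal (gauss (u::'a)) \<partial>lborel)"
  proof (intro nn_integral_cong)
    fix u :: 'a
    have "ennreal (gauss u) = 2 * ennreal (gauss u / 2)"
      using ennreal_mult[of 2 "gauss u / 2"] by simp
    then show "(L2_sq f + L2_sq f) * ennreal (gauss u / 2) = L2_sq f * ennreal (gauss u)"
      by (simp add: mult_ac distrib_right flip: mult_2)
  qed
  also have "\<dots> = L2_sq f"
    by (simp add: nn_integral_cmult nn_integral_gauss)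
  finally show ?thesis .
qed

text \<open>One half of Plancherel: the regularised bound is uniform in \<epsilon>, and Fatou
  removes the weight as \<epsilon> tends to 0.\<close>

lemma L2_sq_fourier_le:
  fixes f :: "'a::euclidean_space \<Rightarrow> complex"
  assumes f: "f \<in> L1"
  shows "L2_sq (fourier f) \<le> L2_sq f"
proof -
  note [measurable] = L1_measurable[OF f] fourier_measurable[OF L1_measurable[OF f]]
  define u where "u n \<xi> = (norm (fourier f \<xi>))\<^sup>2 * gauss ((1 / real (Suc n)) *\<^sub>R \<xi>)" for n \<xi>
  have [measurable]: "u n \<in> borel_measurable borel" for n unfolding u_def by measurable
  have lim: "(\<lambda>n. ennreal (u n \<xi>)) \<longlonglongrightarrow> ennreal ((norm (fourier f \<xi>))\<^sup>2)" for \<xi>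
  proof -
    have "(\<lambda>n. u n \<xi>) \<longlonglongrightarrow> (norm (fourier f \<xi>))\<^sup>2 * 1"
      unfolding u_def by (intro tendsto_intros gauss_scaled_tendsto)
    then show ?thesis by (intro tendsto_ennrealI) simp
  qed
  have le: "(\<integral>\<^sup>+\<xi>. ennreal (u n \<xi>) \<partial>lborel) \<le> L2_sq f" for n
    using fourier_gauss_regularised_le[OF f, of "1 / real (Suc n)"]
      nn_integral_eq_integral[OF fourier_gauss_regularised(1)[OF f, of "1 / real (Suc n)"]]
    by (simp add: u_def)
  have "L2_sq (fourier f) = (\<integral>\<^sup>+\<xi>. liminf (\<lambda>n. ennreal (u n \<xi>)) \<partial>lborel)"
    unfolding L2_sq_def by (intro nn_integral_cong lim_imp_Liminf[symmetric] lim) simp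
  also have "\<dots> \<le> liminf (\<lambda>n. \<integral>\<^sup>+\<xi>. ennreal (u n \<xi>) \<partial>lborel)"
    by (rule nn_integral_liminf) simp
  also have "\<dots> \<le> limsup (\<lambda>n. \<integral>\<^sup>+\<xi>. ennreal (u n \<xi>) \<partial>lborel)"
    by (rule Liminf_le_Limsup) simp
  also have "\<dots> \<le> L2_sq f"
    by (rule Limsup_bounded) (auto simp: le)
  finally show ?thesis .
qed

text \<open>The other half. Continuity makes the Gaussian averages of g converge to g pointwise, and
  the bound C supplies the dominating functions; hence the regularised integrals tend to the squared
  norm of g. Each of them is at most \<open>L2_sq (fourier g)\<close> because the weight is at most
  1.\<close>

lemma L2_sq_le_fourier_continuous:
  fixes g :: "'a::euclidean_space \<Rightarrow> complex"
  assumes g: "g \<in> L1" and cont: "continuous_on UNIV g" and bound: "\<And>x. norm (g x) \<le> C"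
  shows "L2_sq g \<le> L2_sq (fourier g)"
proof -
  note [measurable] = L1_measurable[OF g] fourier_measurable[OF L1_measurable[OF g]]
  have "0 \<le> C" using bound[of 0] norm_ge_zero order_trans by blast
  define r where "r n = (LINT \<xi>|lborel. (norm (fourier g \<xi>))\<^sup>2 * gauss ((1 / real (Suc n)) *\<^sub>R \<xi>))" for n
  define c where "c n x = (LINT u|lborel. g (x + (1 / real (Suc n)) *\<^sub>R u) * of_real (gauss u))" for n x
  have [measurable]: "c n \<in> borel_measurable borel" for n
    unfolding c_def by measurable
  have gC: "norm (g x * of_real (gauss u)) \<le> C * gauss u" for x u
    by (simp add: norm_mult bound mult_right_mono)
  have int_w: "integrable lborel (\<lambda>u::'a. C * gauss u)"
    by (intro integrable_mult_right integrable_gauss)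
  have lim_c: "(\<lambda>n. c n x) \<longlonglongrightarrow> g x" for x
  proof -
    have "(\<lambda>n. c n x) \<longlonglongrightarrow> (LINT u|lborel. g x * of_real (gauss (u::'a)))"
      unfolding c_def
    proof (rule integral_dominated_convergence[OF _ _ int_w])
      show "AE u in lborel. (\<lambda>n. g (x + (1 / real (Suc n)) *\<^sub>R u) * of_real (gauss u))
          \<longlonglongrightarrow> g x * of_real (gauss u)"
      proof (rule AE_I2)
        fix u
        have "(\<lambda>n. x + (1 / real (Suc n)) *\<^sub>R u) \<longlonglongrightarrow> x + 0 *\<^sub>R u"
          by (intro tendsto_intros LIMSEQ_Suc[OF lim_1_over_n])
        then have "(\<lambda>n. g (x + (1 / real (Suc n)) *\<^sub>R u)) \<longlonglongrightarrow> g x"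
          using cont by (auto intro!: continuous_on_tendsto_compose[of UNIV g])
        then show "(\<lambda>n. g (x + (1 / real (Suc n)) *\<^sub>R u) * of_real (gauss u))
            \<longlonglongrightarrow> g x * of_real (gauss u)" by (intro tendsto_intros)
      qed
    qed (auto simp: gC)
    then show ?thesis by (simp add: integral_gauss)
  qed
  have norm_c: "norm (c n x) \<le> C" for n x
  proof -
    have "norm (c n x) \<le> (LINT u|lborel. C * gauss (u::'a))"
      unfolding c_def
      by (rule order_trans[OF Bochner_Integration.integral_norm_bound integral_mono'[OF int_w gC]])
        (simp add: \<open>0 \<le> C\<close>)
    then show ?thesis by (simp add: integral_gauss)
  qed
  have int_Cg: "integrable lborel (\<lambda>x. C * norm (g x))"
    using g by (simp add: L1_def)
  have "(\<lambda>n. LINT x|lborel. g x * cnj (c n x)) \<longlonglongrightarrow> (LINT x|lborel. g x * cnj (g x))"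
  proof (rule integral_dominated_convergence[OF _ _ int_Cg])
    show "AE x in lborel. (\<lambda>n. g x * cnj (c n x)) \<longlonglongrightarrow> g x * cnj (g x)"
      by (intro AE_I2 tendsto_intros lim_c)
    show "AE x in lborel. norm (g x * cnj (c n x)) \<le> C * norm (g x)" for n
      using norm_c by (auto simp: norm_mult mult.commute[of C] intro!: mult_left_mono)
  qed auto
  moreover have "(LINT x|lborel. g x * cnj (c n x)) = complex_of_real (r n)" for n
    using fourier_gauss_regularised(2)[OF g, of "1 / real (Suc n)"] by (simp add: r_def c_def)
  moreover have "(LINT x|lborel. g x * cnj (g x)) = complex_of_real (LINT x|lborel. (norm (g x))\<^sup>2)"
    by (simp only: complex_norm_square[symmetric] integral_complex_of_real)
  ultimately have "r \<longlonglongrightarrow> (LINT x|lborel. (norm (g x))\<^sup>2)"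
    by (simp only: tendsto_of_real_iff)
  then have "(\<lambda>n. ennreal (r n)) \<longlonglongrightarrow> ennreal (LINT x|lborel. (norm (g x))\<^sup>2)"
    by (rule tendsto_ennrealI)
  moreover have "ennreal (r n) \<le> L2_sq (fourier g)" for n
  proof -
    have "ennreal (r n) = (\<integral>\<^sup>+\<xi>. ennreal ((norm (fourier g \<xi>))\<^sup>2 * gauss ((1 / real (Suc n)) *\<^sub>R \<xi>)) \<partial>lborel)"
      unfolding r_def by (intro nn_integral_eq_integral[symmetric] fourier_gauss_regularised g) auto
    also have "\<dots> \<le> L2_sq (fourier g)"
      unfolding L2_sq_def by (intro nn_integral_mono ennreal_leI mult_left_le gauss_le_1) simp
    finally show ?thesis .
  qed
  ultimately have "ennreal (LINT x|lborel. (norm (g x))\<^sup>2) \<le> L2_sq (fourier g)"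
    by (intro LIMSEQ_le_const2) auto
  moreover have "integrable lborel (\<lambda>x. (norm (g x))\<^sup>2)"
    using int_Cg
    by (rule Bochner_Integration.integrable_bound)
      (use \<open>0 \<le> C\<close> in \<open>auto simp: power2_eq_square intro!: mult_right_mono bound\<close>)
  ultimately show ?thesis
    unfolding L2_sq_def by (simp add: nn_integral_eq_integral)
qed

section \<open>Plancherel and the Fourier transform on \<open>L\<^sup>2\<close>\<close>

text \<open>Where the square integral is infinite, \<open>enn2real\<close> yields 0, so the value is
  meaningful only on \<open>L2\<close>; hence the membership assumptions in the norm laws.\<close>

definition L2_norm :: "('a::euclidean_space \<Rightarrow> complex) \<Rightarrow> real"
  where "L2_norm f = sqrt (enn2real (L2_sq f))"

lemma L2_norm_nonneg [simp]: "0 \<le> L2_norm f"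
  by (simp add: L2_norm_def)

lemma L2_sq_eq_norm: "f \<in> L2 \<Longrightarrow> L2_sq f = ennreal ((L2_norm f)\<^sup>2)"
  by (simp add: L2_norm_def L2_iff)

lemma L2_norm_cong: "AE x in lborel. f x = g x \<Longrightarrow> L2_norm f = L2_norm g"
  by (simp add: L2_norm_def L2_sq_cong)

lemma L2_norm_eq_0:
  assumes "f \<in> L2" "L2_norm f = 0"
  shows "AE x in lborel. f x = 0"
  using assms L2_sq_eq_norm[of f] by (intro L2_sq_eq_0) (auto simp: L2_measurable)

lemma L2_norm_diff_commute: "L2_norm (\<lambda>x. f x - g x) = L2_norm (\<lambda>x. g x - f x)"
  by (simp add: L2_norm_def L2_sq_diff_commute[of f g])

lemma L2_norm_cmult:
  assumes "f \<in> L2"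
  shows "L2_norm (\<lambda>x. c * f x) = norm c * L2_norm f"
  using L2_measurable[OF assms]
  by (simp add: L2_norm_def L2_sq_cmult enn2real_mult real_sqrt_mult)

lemma L2_norm_scales:
  assumes "scales_lborel T c" "f \<in> L2"
  shows "L2_norm (\<lambda>x. f (T x)) = sqrt c * L2_norm f"
  using L2_measurable[OF assms(2)] scales_pos[OF assms(1)]
  by (simp add: L2_norm_def L2_sq_scales[OF assms(1)] enn2real_mult real_sqrt_mult)

lemma L2_norm_add:
  assumes f: "f \<in> L2" and g: "g \<in> L2"
  shows "L2_norm (\<lambda>x. f x + g x) \<le> L2_norm f + L2_norm g"
proof -
  let ?a = "L2_norm f" and ?b = "L2_norm g" and ?c = "L2_norm (\<lambda>x. f x + g x)"
  consider "?a = 0" | "?b = 0" | "0 < ?a" "0 < ?b"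
    using L2_norm_nonneg[of f] L2_norm_nonneg[of g] by linarith
  then show ?thesis
  proof cases
    case 1
    then have "?c = ?b"
      using L2_norm_eq_0[OF f] by (intro L2_norm_cong) (auto elim!: eventually_mono)
    then show ?thesis by simp
  next
    case 2
    then have "?c = ?a"
      using L2_norm_eq_0[OF g] by (intro L2_norm_cong) (auto elim!: eventually_mono)
    then show ?thesis by simp
  next
    case 3
    \<comment> \<open>This value minimises the right side of \<open>L2_sq_add_le\<close> and turns
      it into the square of ?a + ?b. It needs both norms positive, which is why vanishing norms are
      treated separately.\<close>
    define \<delta> where "\<delta> = ?b / ?a"
    have \<delta>: "0 < \<delta>" using 3 by (simp add: \<delta>_def)
    have "ennreal (?c\<^sup>2) = L2_sq (\<lambda>x. f x + g x)"
      using L2_sq_eq_norm[OF L2_add[OF f g]] by simp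
    also have "\<dots> \<le> ennreal (1 + \<delta>) * ennreal (?a\<^sup>2) + ennreal (1 + 1 / \<delta>) * ennreal (?b\<^sup>2)"
      using L2_sq_add_le[OF L2_measurable[OF f] L2_measurable[OF g] \<delta>]
      by (simp only: L2_sq_eq_norm[OF f] L2_sq_eq_norm[OF g])
    also have "\<dots> = ennreal ((1 + \<delta>) * ?a\<^sup>2 + (1 + 1 / \<delta>) * ?b\<^sup>2)"
      using \<delta> by (simp add: ennreal_mult ennreal_plus)
    also have "(1 + \<delta>) * ?a\<^sup>2 + (1 + 1 / \<delta>) * ?b\<^sup>2 = (?a + ?b)\<^sup>2"
      using 3 by (simp add: \<delta>_def field_simps power2_eq_square)
    finally have "?c\<^sup>2 \<le> (?a + ?b)\<^sup>2" by (simp add: ennreal_le_iff)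
    then show ?thesis by (rule power2_le_imp_le) simp
  qed
qed

lemma L2_norm_triangle:
  assumes "f \<in> L2" "g \<in> L2" "h \<in> L2"
  shows "L2_norm (\<lambda>x. f x - h x) \<le> L2_norm (\<lambda>x. f x - g x) + L2_norm (\<lambda>x. g x - h x)"
  using L2_norm_add[OF L2_diff[OF assms(1,2)] L2_diff[OF assms(2,3)]] by simp

lemma L2_norm_diff_ineq:
  assumes "f \<in> L2" "g \<in> L2"
  shows "\<bar>L2_norm f - L2_norm g\<bar> \<le> L2_norm (\<lambda>x. f x - g x)"
  using L2_norm_add[OF L2_diff[OF assms] assms(2)] L2_norm_add[OF L2_diff[OF assms(2,1)] assms(1)]
    L2_norm_diff_commute[of f g] by simp

lemma L2_tendsto_norm_iff:
  assumes "\<And>n. \<phi> n \<in> L2" "f \<in> L2"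
  shows "L2_tendsto \<phi> f \<longleftrightarrow> (\<lambda>n. L2_norm (\<lambda>x. \<phi> n x - f x)) \<longlonglongrightarrow> 0"
proof -
  let ?a = "\<lambda>n. L2_norm (\<lambda>x. \<phi> n x - f x)"
  have "L2_tendsto \<phi> f \<longleftrightarrow> (\<lambda>n. ennreal ((?a n)\<^sup>2)) \<longlonglongrightarrow> ennreal 0"
    using assms by (simp add: L2_tendsto_iff L2_sq_eq_norm L2_diff)
  also have "\<dots> \<longleftrightarrow> (\<lambda>n. (?a n)\<^sup>2) \<longlonglongrightarrow> 0"
    by (intro tendsto_ennreal_iff) auto
  also have "\<dots> \<longleftrightarrow> ?a \<longlonglongrightarrow> 0"
  proof
    assume "(\<lambda>n. (?a n)\<^sup>2) \<longlonglongrightarrow> 0"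
    then have "(\<lambda>n. sqrt ((?a n)\<^sup>2)) \<longlonglongrightarrow> sqrt 0" by (rule tendsto_real_sqrt)
    then show "?a \<longlonglongrightarrow> 0" by simp
  next
    assume "?a \<longlonglongrightarrow> 0"
    then have "(\<lambda>n. (?a n)\<^sup>2) \<longlonglongrightarrow> 0\<^sup>2" by (rule tendsto_power)
    then show "(\<lambda>n. (?a n)\<^sup>2) \<longlonglongrightarrow> 0" by simp
  qed
  finally show ?thesis .
qed

lemma L2_norm_tendsto:
  assumes "\<And>n. \<phi> n \<in> L2" "f \<in> L2" "L2_tendsto \<phi> f"
  shows "(\<lambda>n. L2_norm (\<phi> n)) \<longlonglongrightarrow> L2_norm f"
proof -
  have "(\<lambda>n. L2_norm (\<phi> n) - L2_norm f) \<longlonglongrightarrow> 0"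
    using assms(3) unfolding L2_tendsto_norm_iff[OF assms(1,2)]
    by (rule Lim_null_comparison[rotated])
      (simp add: assms(1,2) L2_norm_diff_ineq always_eventually)
  then show ?thesis by (simp add: LIM_zero_iff)
qed

lemma L2_tendsto_diff:
  assumes "\<And>n. \<phi> n \<in> L2" "f \<in> L2" "L2_tendsto \<phi> f"
    and "\<And>n. \<psi> n \<in> L2" "g \<in> L2" "L2_tendsto \<psi> g"
  shows "L2_tendsto (\<lambda>n x. \<phi> n x - \<psi> n x) (\<lambda>x. f x - g x)"
proof -
  have mem: "(\<lambda>x. \<phi> n x - \<psi> n x) \<in> L2" "(\<lambda>x. f x - g x) \<in> L2" for n
    using assms by (auto intro: L2_diff)
  have le: "L2_norm (\<lambda>x. (\<phi> n x - \<psi> n x) - (f x - g x))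
      \<le> L2_norm (\<lambda>x. \<phi> n x - f x) + L2_norm (\<lambda>x. \<psi> n x - g x)" for n
  proof -
    have "L2_norm (\<lambda>x. (\<phi> n x - \<psi> n x) - (f x - g x)) = L2_norm (\<lambda>x. (\<phi> n x - f x) + (g x - \<psi> n x))"
      by (simp add: algebra_simps)
    also have "\<dots> \<le> L2_norm (\<lambda>x. \<phi> n x - f x) + L2_norm (\<lambda>x. g x - \<psi> n x)"
      using assms by (intro L2_norm_add L2_diff)
    finally show ?thesis by (simp add: L2_norm_diff_commute[of g])
  qed
  have "(\<lambda>n. L2_norm (\<lambda>x. \<phi> n x - f x) + L2_norm (\<lambda>x. \<psi> n x - g x)) \<longlonglongrightarrow> 0 + 0"
    using assms(3,6) unfolding L2_tendsto_norm_iff[OF assms(1,2)] L2_tendsto_norm_iff[OF assms(4,5)]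
    by (rule tendsto_add)
  then show ?thesis
    unfolding L2_tendsto_norm_iff[OF mem]
    by (intro Lim_null_comparison[of "\<lambda>n. L2_norm (\<lambda>x. (\<phi> n x - \<psi> n x) - (f x - g x))"])
      (auto simp: le)
qed

text \<open>The limit inherits the bound by w almost everywhere, so the squared differences are
  dominated by 4 |w|^2 and ordinary dominated convergence applies.\<close>

lemma L2_dominated_convergence:
  assumes [measurable]: "\<And>n. \<phi> n \<in> borel_measurable borel" "f \<in> borel_measurable borel"
    and "w \<in> L2" and bound: "\<And>n x. norm (\<phi> n x) \<le> norm (w x)"
    and lim: "AE x in lborel. (\<lambda>n. \<phi> n x) \<longlonglongrightarrow> f x"
  shows "L2_tendsto \<phi> f"
proof -
  note [measurable] = L2_measurable[OF \<open>w \<in> L2\<close>]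
  have "(\<lambda>n. \<integral>\<^sup>+x. ennreal ((norm (\<phi> n x - f x))\<^sup>2) \<partial>lborel) \<longlonglongrightarrow> (\<integral>\<^sup>+(x::'a). 0 \<partial>lborel)"
  proof (rule nn_integral_dominated_convergence)
    show "AE x in lborel. ennreal ((norm (\<phi> n x - f x))\<^sup>2) \<le> ennreal 4 * ennreal ((norm (w x))\<^sup>2)" for n
      using lim
    proof eventually_elim
      fix x assume "(\<lambda>n. \<phi> n x) \<longlonglongrightarrow> f x"
      then have "norm (f x) \<le> norm (w x)"
        by (intro LIMSEQ_le_const2[OF tendsto_norm]) (auto simp: bound)
      then have "norm (\<phi> n x - f x) \<le> 2 * norm (w x)"
        using norm_triangle_ineq4[of "\<phi> n x" "f x"] bound[of n x] by linarith
      then have "(norm (\<phi> n x - f x))\<^sup>2 \<le> (2 * norm (w x))\<^sup>2"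
        by (intro power_mono) auto
      then show "ennreal ((norm (\<phi> n x - f x))\<^sup>2) \<le> ennreal 4 * ennreal ((norm (w x))\<^sup>2)"
        by (subst ennreal_mult[symmetric]) (auto simp: power_mult_distrib intro: ennreal_leI)
    qed
    show "(\<integral>\<^sup>+x. ennreal 4 * ennreal ((norm (w x))\<^sup>2) \<partial>lborel) < \<infinity>"
      using \<open>w \<in> L2\<close> by (simp add: nn_integral_cmult L2_iff L2_sq_def ennreal_mult_less_top)
    show "AE x in lborel. (\<lambda>n. ennreal ((norm (\<phi> n x - f x))\<^sup>2)) \<longlonglongrightarrow> 0"
      using lim
    proof eventually_elim
      fix x assume "(\<lambda>n. \<phi> n x) \<longlonglongrightarrow> f x"
      then have "(\<lambda>n. (norm (\<phi> n x - f x))\<^sup>2) \<longlonglongrightarrow> (norm (f x - f x))\<^sup>2"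
        by (intro tendsto_intros)
      then have "(\<lambda>n. ennreal ((norm (\<phi> n x - f x))\<^sup>2)) \<longlonglongrightarrow> ennreal ((norm (f x - f x))\<^sup>2)"
        by (rule tendsto_ennrealI)
      then show "(\<lambda>n. ennreal ((norm (\<phi> n x - f x))\<^sup>2)) \<longlonglongrightarrow> 0" by simp
    qed
  qed auto
  then show ?thesis by (simp add: L2_tendsto_def)
qed

section \<open>Approximation by bounded continuous functions, and the Plancherel theorem\<close>

text \<open>For k > 0, the radial retraction onto the closed disc of radius k. The maximum keeps the
  denominator positive, so continuity needs no case distinction.\<close>

definition clamp_norm :: "real \<Rightarrow> complex \<Rightarrow> complex"
  where "clamp_norm k z = of_real (k / max k (norm z)) * z"

lemma
  assumes "0 < k"
  shows norm_clamp_le: "norm (clamp_norm k z) \<le> k"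
    and norm_clamp_le_norm: "norm (clamp_norm k z) \<le> norm z"
    and clamp_norm_id: "norm z \<le> k \<Longrightarrow> clamp_norm k z = z"
    and continuous_on_clamp: "continuous_on A (clamp_norm k)"
proof -
  have pos: "0 < max k (norm z)" for z :: complex using assms by (simp add: less_max_iff_disj)
  have eq: "norm (clamp_norm k z) = k / max k (norm z) * norm z"
    unfolding clamp_norm_def norm_mult norm_of_real using assms pos[of z] by (simp add: abs_of_pos)
  have "norm z / max k (norm z) \<le> 1" using pos[of z] by simp
  then have "k * (norm z / max k (norm z)) \<le> k * 1" using assms by (intro mult_left_mono) auto
  then show "norm (clamp_norm k z) \<le> k" by (simp add: eq)
  have "k / max k (norm z) \<le> 1" using assms pos[of z] by simp
  then have "k / max k (norm z) * norm z \<le> 1 * norm z" by (rule mult_right_mono) simp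
  then show "norm (clamp_norm k z) \<le> norm z" by (simp only: eq mult_1)
  show "norm z \<le> k \<Longrightarrow> clamp_norm k z = z"
    using assms by (auto simp: clamp_norm_def max_def)
  show "continuous_on A (clamp_norm k)"
    unfolding clamp_norm_def using pos by (intro continuous_intros) (metis less_irrefl)
qed

lemma L2_gauss: "(\<lambda>x::'a::euclidean_space. complex_of_real (gauss x)) \<in> L1 \<inter> L2"
proof -
  have "integrable lborel (\<lambda>x::'a. (gauss x)\<^sup>2)"
    by (rule Bochner_Integration.integrable_bound[OF integrable_gauss])
      (auto simp: power2_eq_square gauss_le_1 intro!: mult_left_le)
  then show ?thesis
    by (simp add: L1_def L2_def complex_of_real_integrable_eq integrable_gauss)
qed

text \<open>Truncating the quotient f / gauss instead of f makes every approximant bounded by a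
  multiple of the Gaussian, which places it in \<open>L1\<close> and \<open>L2\<close> at
  once.\<close>

lemma L2_truncation:
  assumes f: "f \<in> L2"
  defines "\<phi> \<equiv> \<lambda>n x. of_real (gauss x) * clamp_norm (real (Suc n)) (f x / of_real (gauss x))"
  shows "L2_tendsto \<phi> f"
proof (rule L2_dominated_convergence[OF _ L2_measurable[OF f] f])
  note [measurable] = L2_measurable[OF f]
  have [measurable]: "clamp_norm (real (Suc n)) \<in> borel_measurable borel" for n
    by (intro borel_measurable_continuous_onI continuous_on_clamp) simp
  show "\<phi> n \<in> borel_measurable borel" for n unfolding \<phi>_def by measurable
  show "norm (\<phi> n x) \<le> norm (f x)" for n x
  proof -
    have "norm (\<phi> n x) \<le> gauss x * norm (f x / of_real (gauss x))"
      unfolding \<phi>_def norm_mult using norm_clamp_le_norm[of "real (Suc n)"]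
      by (simp only: norm_of_real abs_of_nonneg[OF gauss_nonneg]) (intro mult_left_mono, auto)
    then show ?thesis using gauss_pos[of x] by (simp add: norm_divide less_imp_neq[symmetric])
  qed
  show "AE x in lborel. (\<lambda>n. \<phi> n x) \<longlonglongrightarrow> f x"
  proof (rule AE_I2)
    fix x
    obtain N where N: "norm (f x / of_real (gauss x)) \<le> real N" using real_arch_simple by blast
    have "eventually (\<lambda>n. \<phi> n x = f x) sequentially"
      using eventually_ge_at_top[of N]
    proof eventually_elim
      case (elim n)
      then have "clamp_norm (real (Suc n)) (f x / of_real (gauss x)) = f x / of_real (gauss x)"
        using N by (intro clamp_norm_id) auto
      then show ?case using gauss_pos[of x] by (simp add: \<phi>_def less_imp_neq[symmetric])
    qed
    then show "(\<lambda>n. \<phi> n x) \<longlonglongrightarrow> f x" by (rule tendsto_eventually)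
  qed
qed

lemma L1_L2_gauss_bounded:
  fixes f :: "'a::euclidean_space \<Rightarrow> complex"
  assumes "f \<in> borel_measurable borel" "\<And>x. norm (f x) \<le> k * gauss x"
  shows "f \<in> L1 \<inter> L2"
proof -
  have le: "norm (f x) \<le> norm (of_real k * complex_of_real (gauss x))" for x
    using order_trans[OF assms(2)[of x] mult_right_mono[OF abs_ge_self[of k] gauss_nonneg[of x]]]
    by (simp add: norm_mult)
  have w: "(\<lambda>x::'a. of_real k * complex_of_real (gauss x)) \<in> L1 \<inter> L2"
    using L1_cmult[of "\<lambda>x::'a. complex_of_real (gauss x)" "of_real k"]
      L2_cmult[of "\<lambda>x::'a. complex_of_real (gauss x)" "of_real k"] L2_gauss[where 'a='a] by simp
  have "f \<in> L2" by (rule L2_bound[OF _ assms(1) le]) (use w in simp)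
  moreover have "f \<in> L1"
    unfolding L1_def mem_Collect_eq
    by (rule Bochner_Integration.integrable_bound[of _ "\<lambda>x. of_real k * complex_of_real (gauss x)"])
      (use w assms(1) le in \<open>auto simp: L1_def\<close>)
  ultimately show ?thesis by simp
qed

text \<open>Two approximations: first by a Gaussian times a bounded measurable function, then of
  that bounded factor by continuous functions. The Gaussian weight provides the dominating function
  in the second step.\<close>

lemma L2_approx_continuous:
  fixes f :: "'a::euclidean_space \<Rightarrow> complex"
  assumes f: "f \<in> L2" and "0 < e"
  obtains g C where "g \<in> L1 \<inter> L2" "continuous_on UNIV g" "\<And>x. norm (g x) \<le> C"
    "L2_norm (\<lambda>x. g x - f x) < e"
proof -
  note [measurable] = L2_measurable[OF f]
  have clamp[measurable]: "clamp_norm (real (Suc n)) \<in> borel_measurable borel" for n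
    by (intro borel_measurable_continuous_onI continuous_on_clamp) simp
  define \<phi> where "\<phi> n x = of_real (gauss x) * clamp_norm (real (Suc n)) (f x / of_real (gauss x))" for n x
  have [measurable]: "\<phi> n \<in> borel_measurable borel" for n unfolding \<phi>_def by measurable
  have \<phi>: "\<phi> n \<in> L1 \<inter> L2" for n
    by (rule L1_L2_gauss_bounded[of _ "real (Suc n)"])
      (auto simp: \<phi>_def norm_mult mult.commute[of _ "gauss _"] intro!: mult_left_mono norm_clamp_le simp del: of_nat_Suc)
  have "(\<lambda>n. L2_norm (\<lambda>x. \<phi> n x - f x)) \<longlonglongrightarrow> 0"
    using L2_truncation[OF f] \<phi> f by (subst L2_tendsto_norm_iff[symmetric]) (auto simp: \<phi>_def[abs_def])
  then have "eventually (\<lambda>n. L2_norm (\<lambda>x. \<phi> n x - f x) < e / 2) sequentially"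
    using \<open>0 < e\<close> by (intro order_tendstoD) auto
  then obtain n where n: "L2_norm (\<lambda>x. \<phi> n x - f x) < e / 2"
    by (auto dest: eventually_happens)
  define k where "k = real (Suc n)"
  have k: "0 < k" by (simp add: k_def)
  define u where "u x = clamp_norm k (f x / of_real (gauss x))" for x
  have [measurable]: "u \<in> borel_measurable borel" unfolding u_def k_def by measurable
  \<comment> \<open>By definition this yields continuous functions converging to u off a negligible
    set.\<close>
  have "u measurable_on UNIV"
    by (rule lebesgue_measurable_imp_measurable_on) (auto intro: measurable_completion)
  then obtain N G where N: "negligible N" and G: "\<And>m. continuous_on UNIV (G m)"
    and lim: "\<And>x. x \<notin> N \<Longrightarrow> (\<lambda>m. G m x) \<longlonglongrightarrow> u x"
    unfolding measurable_on_def by auto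
  \<comment> \<open>The continuous functions carry no uniform bound; clamping restores one and does
    not change the limit, because u already lies in the disc.\<close>
  define \<psi> where "\<psi> m x = of_real (gauss x) * clamp_norm k (G m x)" for m x
  have cont: "continuous_on UNIV (\<psi> m)" for m
    unfolding \<psi>_def
    by (intro continuous_intros continuous_on_gauss continuous_on_compose2[OF continuous_on_clamp[OF k, of UNIV] G]) auto
  then have [measurable]: "\<psi> m \<in> borel_measurable borel" for m
    by (rule borel_measurable_continuous_onI)
  have \<psi>_le: "norm (\<psi> m x) \<le> k * gauss x" for m x
    by (simp add: \<psi>_def norm_mult mult.commute[of k] mult_left_mono norm_clamp_le k)
  have \<psi>: "\<psi> m \<in> L1 \<inter> L2" for m
    by (rule L1_L2_gauss_bounded[OF _ \<psi>_le]) simp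
  have "L2_tendsto \<psi> (\<phi> n)"
  proof (rule L2_dominated_convergence)
    show "(\<lambda>x. of_real k * complex_of_real (gauss x)) \<in> L2"
      using L2_gauss by (intro L2_cmult) auto
    show "norm (\<psi> m x) \<le> norm (of_real k * complex_of_real (gauss x))" for m x
      using \<psi>_le[of m x] k by (simp add: norm_mult)
    have "AE x in lebesgue. x \<notin> N"
      using N by (intro AE_not_in) (simp add: negligible_iff_null_sets)
    then have "AE x in lborel. x \<notin> N"
      by (simp add: AE_completion_iff)
    then show "AE x in lborel. (\<lambda>m. \<psi> m x) \<longlonglongrightarrow> \<phi> n x"
    proof eventually_elim
      fix x assume "x \<notin> N"
      then have "(\<lambda>m. clamp_norm k (G m x)) \<longlonglongrightarrow> clamp_norm k (u x)"
        using continuous_on_clamp[OF k, of UNIV] lim by (auto intro: continuous_on_tendsto_compose[of UNIV])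
      moreover have "clamp_norm k (u x) = u x"
        by (intro clamp_norm_id k) (simp add: u_def norm_clamp_le k)
      ultimately show "(\<lambda>m. \<psi> m x) \<longlonglongrightarrow> \<phi> n x"
        unfolding \<psi>_def \<phi>_def by (intro tendsto_intros) (simp add: u_def k_def)
    qed
  qed auto
  then have "(\<lambda>m. L2_norm (\<lambda>x. \<psi> m x - \<phi> n x)) \<longlonglongrightarrow> 0"
    using \<psi> \<phi> by (subst (asm) L2_tendsto_norm_iff) auto
  then have "eventually (\<lambda>m. L2_norm (\<lambda>x. \<psi> m x - \<phi> n x) < e / 2) sequentially"
    using \<open>0 < e\<close> by (intro order_tendstoD) auto
  then obtain m where m: "L2_norm (\<lambda>x. \<psi> m x - \<phi> n x) < e / 2"
    by (auto dest: eventually_happens)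
  have "L2_norm (\<lambda>x. \<psi> m x - f x) < e"
    using L2_norm_triangle[of "\<psi> m" "\<phi> n" f] \<phi>[of n] \<psi>[of m] f m n by simp
  moreover have "norm (\<psi> m x) \<le> k" for x
    using order_trans[OF \<psi>_le[of m x] mult_left_le[OF gauss_le_1]] k by simp
  ultimately show ?thesis using that \<psi> cont by blast
qed

lemma fourier_in_L2:
  assumes "f \<in> L1 \<inter> L2"
  shows "fourier f \<in> L2"
  using assms L2_sq_fourier_le[of f] fourier_measurable[of f] L1_measurable[of f]
  by (auto simp: L2_iff intro: le_less_trans)

text \<open>The lower bound is known for bounded continuous functions. It extends to f by density,
  since both norms move by at most the L^2 distance; on the frequency side this uses the upper bound
  applied to the difference.\<close>

theorem plancherel:
  fixes f :: "'a::euclidean_space \<Rightarrow> complex"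
  assumes f: "f \<in> L1 \<inter> L2"
  shows "L2_norm (fourier f) = L2_norm f"
proof -
  have le: "L2_norm (fourier h) \<le> L2_norm h" if "h \<in> L1 \<inter> L2" for h :: "'a \<Rightarrow> complex"
    using L2_sq_fourier_le[of h] that fourier_in_L2[OF that]
    by (simp add: L2_sq_eq_norm abs_le_square_iff[symmetric])
  have "L2_norm f \<le> L2_norm (fourier f)"
  proof (rule field_le_epsilon)
    fix e :: real assume "0 < e"
    then obtain g C where g: "g \<in> L1 \<inter> L2" "continuous_on UNIV g" "\<And>x. norm (g x) \<le> C"
      and e: "L2_norm (\<lambda>x. g x - f x) < e / 2"
      using L2_approx_continuous[of f "e / 2"] f by auto
    have "L2_sq g \<le> L2_sq (fourier g)"
      using g by (intro L2_sq_le_fourier_continuous) auto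
    then have "L2_norm g \<le> L2_norm (fourier g)"
      using g(1) fourier_in_L2[OF g(1)] by (simp add: L2_sq_eq_norm abs_le_square_iff[symmetric])
    moreover have "L2_norm (\<lambda>\<xi>. fourier g \<xi> - fourier f \<xi>) \<le> L2_norm (\<lambda>x. g x - f x)"
    proof -
      have "(\<lambda>\<xi>. fourier g \<xi> - fourier f \<xi>) = fourier (\<lambda>x. g x - f x)"
        using f g(1) by (simp add: fourier_diff fun_eq_iff)
      then show ?thesis
        using le[of "\<lambda>x. g x - f x"] f g(1) by (simp add: L1_diff L2_diff)
    qed
    moreover have "\<bar>L2_norm (fourier g) - L2_norm (fourier f)\<bar> \<le> L2_norm (\<lambda>\<xi>. fourier g \<xi> - fourier f \<xi>)"
      by (intro L2_norm_diff_ineq fourier_in_L2 f g)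
    moreover have "\<bar>L2_norm g - L2_norm f\<bar> \<le> L2_norm (\<lambda>x. g x - f x)"
      using f g by (intro L2_norm_diff_ineq) auto
    ultimately show "L2_norm f \<le> L2_norm (fourier f) + e"
      using e by linarith
  qed
  with le[OF f] show ?thesis by simp
qed

section \<open>The Fourier transform as a relation on square integrable functions\<close>

text \<open>Plancherel is applied to the differences of the two approximating sequences. Comparing
  two pairs at once gives uniqueness and injectivity as the cases in which one side
  vanishes.\<close>

lemma fourier_L2_isometry:
  assumes "fourier_L2 f g" "fourier_L2 f' g'"
  shows "L2_norm (\<lambda>x. f x - f' x) = L2_norm (\<lambda>\<xi>. g \<xi> - g' \<xi>)"
proof -
  obtain \<phi> \<psi> where f: "f \<in> L2" "g \<in> L2" "f' \<in> L2" "g' \<in> L2"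
    and \<phi>: "\<And>n. \<phi> n \<in> L1 \<inter> L2" "L2_tendsto \<phi> f" "L2_tendsto (\<lambda>n. fourier (\<phi> n)) g"
    and \<psi>: "\<And>n. \<psi> n \<in> L1 \<inter> L2" "L2_tendsto \<psi> f'" "L2_tendsto (\<lambda>n. fourier (\<psi> n)) g'"
    using assms unfolding fourier_L2_def by metis
  have mem: "(\<lambda>x. \<phi> n x - \<psi> n x) \<in> L1 \<inter> L2" for n
    using \<phi>(1)[of n] \<psi>(1)[of n] by (auto intro: L1_diff L2_diff)
  have eq: "(\<lambda>\<xi>. fourier (\<phi> n) \<xi> - fourier (\<psi> n) \<xi>) = fourier (\<lambda>x. \<phi> n x - \<psi> n x)" for n
    using \<phi>(1)[of n] \<psi>(1)[of n] by (simp add: fourier_diff fun_eq_iff)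
  have "L2_tendsto (\<lambda>n x. \<phi> n x - \<psi> n x) (\<lambda>x. f x - f' x)"
    using f \<phi> \<psi> by (intro L2_tendsto_diff) auto
  then have "(\<lambda>n. L2_norm (\<lambda>x. \<phi> n x - \<psi> n x)) \<longlonglongrightarrow> L2_norm (\<lambda>x. f x - f' x)"
    using mem f by (intro L2_norm_tendsto) (auto intro: L2_diff)
  moreover have "L2_tendsto (\<lambda>n \<xi>. fourier (\<phi> n) \<xi> - fourier (\<psi> n) \<xi>) (\<lambda>\<xi>. g \<xi> - g' \<xi>)"
    using f \<phi> \<psi> by (intro L2_tendsto_diff fourier_in_L2) auto
  then have "(\<lambda>n. L2_norm (\<lambda>x. \<phi> n x - \<psi> n x)) \<longlonglongrightarrow> L2_norm (\<lambda>\<xi>. g \<xi> - g' \<xi>)"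
    unfolding eq using L2_norm_tendsto[of "\<lambda>n. fourier (\<lambda>x. \<phi> n x - \<psi> n x)"] mem f
    by (simp add: plancherel fourier_in_L2 L2_diff)
  ultimately show ?thesis by (rule LIMSEQ_unique)
qed

lemma fourier_L2_unique:
  assumes "fourier_L2 f g" "fourier_L2 f g'"
  shows "AE \<xi> in lborel. g \<xi> = g' \<xi>"
proof -
  have "L2_norm (\<lambda>\<xi>. g \<xi> - g' \<xi>) = L2_norm (\<lambda>x. f x - f x)"
    by (rule fourier_L2_isometry[OF assms, symmetric])
  then have "AE \<xi> in lborel. g \<xi> - g' \<xi> = 0"
    using assms by (intro L2_norm_eq_0 L2_diff) (auto simp: fourier_L2_def L2_norm_def L2_sq_def)
  then show ?thesis by simp
qed

lemma fourier_L2_inject: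
  assumes "fourier_L2 f g" "fourier_L2 f' g'" "AE \<xi> in lborel. g \<xi> = g' \<xi>"
  shows "AE x in lborel. f x = f' x"
proof -
  have "L2_norm (\<lambda>x. f x - f' x) = L2_norm (\<lambda>\<xi>. g \<xi> - g' \<xi>)"
    by (rule fourier_L2_isometry[OF assms(1,2)])
  also have "\<dots> = L2_norm (\<lambda>\<xi>::'a. 0)"
    using assms(3) by (intro L2_norm_cong) (auto elim!: eventually_mono)
  finally have "AE x in lborel. f x - f' x = 0"
    using assms by (intro L2_norm_eq_0 L2_diff) (auto simp: fourier_L2_def L2_norm_def L2_sq_def)
  then show ?thesis by simp
qed

lemma L2_tendsto_cmult:
  assumes "\<And>n. \<phi> n \<in> borel_measurable borel" "f \<in> borel_measurable borel" "L2_tendsto \<phi> f"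
  shows "L2_tendsto (\<lambda>n x. c * \<phi> n x) (\<lambda>x. c * f x)"
proof -
  have "L2_sq (\<lambda>x. c * \<phi> n x - c * f x) = ennreal ((norm c)\<^sup>2) * L2_sq (\<lambda>x. \<phi> n x - f x)" for n
    using assms(1)[of n] assms(2) L2_sq_cmult[of "\<lambda>x. \<phi> n x - f x" c] by (simp add: right_diff_distrib)
  moreover have "(\<lambda>n. ennreal ((norm c)\<^sup>2) * L2_sq (\<lambda>x. \<phi> n x - f x)) \<longlonglongrightarrow> ennreal ((norm c)\<^sup>2) * 0"
    using assms(3) by (intro tendsto_mult_ennreal tendsto_const) (auto simp: L2_tendsto_iff)
  ultimately show ?thesis by (simp add: L2_tendsto_iff)
qed

lemma L2_tendsto_scales:
  assumes "scales_lborel T c" "\<And>n. \<phi> n \<in> borel_measurable borel" "f \<in> borel_measurable borel"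
    "L2_tendsto \<phi> f"
  shows "L2_tendsto (\<lambda>n x. \<phi> n (T x)) (\<lambda>x. f (T x))"
proof -
  have "L2_sq (\<lambda>x. \<phi> n (T x) - f (T x)) = ennreal c * L2_sq (\<lambda>x. \<phi> n x - f x)" for n
    using assms(2)[of n] assms(3) L2_sq_scales[OF assms(1), of "\<lambda>x. \<phi> n x - f x"] by simp
  moreover have "(\<lambda>n. ennreal c * L2_sq (\<lambda>x. \<phi> n x - f x)) \<longlonglongrightarrow> ennreal c * 0"
    using assms(4) by (intro tendsto_mult_ennreal tendsto_const) (auto simp: L2_tendsto_iff)
  ultimately show ?thesis by (simp add: L2_tendsto_iff)
qed

lemma L2_mult_wave:
  assumes "f \<in> L2" "h \<in> borel_measurable borel"
  shows "(\<lambda>x. wave (h x) * f x) \<in> L2"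
  using assms L2_measurable[OF assms(1)]
  by (intro L2_bound[OF assms(1)]) (auto simp: norm_mult)

lemma fourier_L2_cmult:
  assumes "fourier_L2 f g"
  shows "fourier_L2 (\<lambda>x. c * f x) (\<lambda>\<xi>. c * g \<xi>)"
proof -
  obtain \<phi> where f: "f \<in> L2" "g \<in> L2"
    and \<phi>: "\<And>n. \<phi> n \<in> L1 \<inter> L2" "L2_tendsto \<phi> f" "L2_tendsto (\<lambda>n. fourier (\<phi> n)) g"
    using assms unfolding fourier_L2_def by metis
  have "L2_tendsto (\<lambda>n x. c * \<phi> n x) (\<lambda>x. c * f x)"
    using f \<phi> by (intro L2_tendsto_cmult) (auto intro: L2_measurable)
  moreover have "L2_tendsto (\<lambda>n. fourier (\<lambda>x. c * \<phi> n x)) (\<lambda>\<xi>. c * g \<xi>)"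
    unfolding fourier_cmult[abs_def]
    using f \<phi> by (intro L2_tendsto_cmult) (auto intro: L2_measurable fourier_in_L2)
  ultimately show ?thesis
    unfolding fourier_L2_def using f \<phi>
    by (intro conjI exI[of _ "\<lambda>n x. c * \<phi> n x"]) (auto intro: L1_cmult L2_cmult)
qed

text \<open>\<open>N\<close> is the adjoint inverse of the linear part of \<open>T\<close>. The
  approximating sequence is composed with \<open>T\<close>, its transforms with \<open>N\<close> and
  a unimodular factor; the two scaling constants keep both convergences.\<close>

lemma fourier_L2_scales:
  assumes "fourier_L2 f g" and T: "scales_lborel T c" and N: "scales_lborel N c'"
    and adj: "\<And>\<xi> x. N \<xi> \<bullet> (T x - w) = \<xi> \<bullet> x"
  shows "fourier_L2 (\<lambda>x. f (T x)) (\<lambda>\<xi>. of_real c * (wave (- (N \<xi> \<bullet> w)) * g (N \<xi>)))"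
proof -
  note [measurable] = scales_measurable[OF T] scales_measurable[OF N]
  obtain \<phi> where f: "f \<in> L2" "g \<in> L2"
    and \<phi>: "\<And>n. \<phi> n \<in> L1 \<inter> L2" "L2_tendsto \<phi> f" "L2_tendsto (\<lambda>n. fourier (\<phi> n)) g"
    using assms(1) unfolding fourier_L2_def by metis
  have meas: "\<phi> n \<in> borel_measurable borel" for n using \<phi>(1)[of n] by (auto intro: L2_measurable)
  have fT: "fourier (\<lambda>x. \<phi> n (T x)) = (\<lambda>\<xi>. of_real c * (wave (- (N \<xi> \<bullet> w)) * fourier (\<phi> n) (N \<xi>)))" for n
    using fourier_scales[OF T meas[of n] adj] by (simp add: fun_eq_iff mult.assoc)
  have "L2_tendsto (\<lambda>n x. \<phi> n (T x)) (\<lambda>x. f (T x))"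
    using f \<phi> by (intro L2_tendsto_scales[OF T] meas) (auto intro: L2_measurable)
  moreover have "L2_tendsto (\<lambda>n. fourier (\<lambda>x. \<phi> n (T x)))
      (\<lambda>\<xi>. of_real c * (wave (- (N \<xi> \<bullet> w)) * g (N \<xi>)))"
    unfolding fT
  proof (rule L2_tendsto_cmult)
    have "L2_tendsto (\<lambda>n \<xi>. fourier (\<phi> n) (N \<xi>)) (\<lambda>\<xi>. g (N \<xi>))"
      using f \<phi> by (intro L2_tendsto_scales[OF N]) (auto intro: L2_measurable fourier_in_L2)
    moreover have "L2_sq (\<lambda>\<xi>. wave (- (N \<xi> \<bullet> w)) * fourier (\<phi> n) (N \<xi>) - wave (- (N \<xi> \<bullet> w)) * g (N \<xi>))
        = L2_sq (\<lambda>\<xi>. fourier (\<phi> n) (N \<xi>) - g (N \<xi>))" for n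
      by (simp add: L2_sq_def norm_mult flip: right_diff_distrib)
    ultimately show "L2_tendsto (\<lambda>n \<xi>. wave (- (N \<xi> \<bullet> w)) * fourier (\<phi> n) (N \<xi>))
        (\<lambda>\<xi>. wave (- (N \<xi> \<bullet> w)) * g (N \<xi>))"
      by (simp add: L2_tendsto_iff)
    show "(\<lambda>\<xi>. wave (- (N \<xi> \<bullet> w)) * fourier (\<phi> n) (N \<xi>)) \<in> borel_measurable borel" for n
      using fourier_measurable[OF meas[of n]] by simp
    show "(\<lambda>\<xi>. wave (- (N \<xi> \<bullet> w)) * g (N \<xi>)) \<in> borel_measurable borel"
      using L2_measurable[OF f(2)] by simp
  qed
  moreover have "\<forall>n. (\<lambda>x. \<phi> n (T x)) \<in> L1 \<inter> L2"
    using \<phi>(1) by (auto intro: L1_scales[OF T] L2_scales[OF T])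
  moreover have "(\<lambda>\<xi>. of_real c * (wave (- (N \<xi> \<bullet> w)) * g (N \<xi>))) \<in> L2"
    using f by (intro L2_cmult L2_mult_wave L2_scales[OF N]) auto
  ultimately show ?thesis
    unfolding fourier_L2_def using L2_scales[OF T f(1)]
    by (intro conjI exI[of _ "\<lambda>n x. \<phi> n (T x)"])
qed

section \<open>Density of \<open>\<A>\<close>\<close>

lemma wave_mult_nat: "wave (real k * t) = wave t ^ k"
proof (induction k)
  case (Suc k)
  have "wave (real (Suc k) * t) = wave (t + real k * t)" by (simp add: algebra_simps)
  then show ?case by (simp only: wave_add Suc power_Suc)
qed simp

lemma norm_one_minus_wave_le: "norm (1 - wave t) \<le> 2 * pi * \<bar>t\<bar>"
proof -
  have "wave t = iexp (- 2 * pi * t)" by (simp add: wave_def mult_ac)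
  then show ?thesis
    using iexp_approx1[of "- 2 * pi * t" 0] by (simp add: norm_minus_commute abs_mult)
qed

lemma wave_eq_1_imp_Ints:
  assumes "wave t = 1"
  shows "t \<in> \<int>"
proof -
  obtain n :: int where "Im (- 2 * of_real pi * \<i> * of_real t) = of_int (2 * n) * pi"
    using assms unfolding wave_def exp_eq_1 by blast
  then have "- t * (2 * pi) = of_int n * (2 * pi)" by simp
  then have "- t = of_int n" by (subst (asm) mult_cancel_right) simp
  then have "t = of_int (- n)" by simp
  then show ?thesis by (metis Ints_of_int)
qed

text \<open>The exceptional frequencies lie in the countably many hyperplanes where the inner
  product with e is an integer.\<close>

lemma AE_wave_inner_neq_1:
  fixes e :: "'a::euclidean_space"
  assumes "e \<noteq> 0"
  shows "AE \<xi> in lborel. wave (\<xi> \<bullet> e) \<noteq> 1"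
proof -
  have "AE \<xi> in lborel. \<xi> \<bullet> e \<noteq> of_int n" for n
  proof -
    have "negligible {\<xi>. e \<bullet> \<xi> = of_int n}"
      using assms by (intro negligible_hyperplane) simp
    then have "AE \<xi> in lebesgue. \<xi> \<notin> {\<xi>. e \<bullet> \<xi> = of_int n}"
      by (intro AE_not_in) (simp add: negligible_iff_null_sets)
    then show ?thesis by (simp add: AE_completion_iff inner_commute)
  qed
  then have "AE \<xi> in lborel. \<forall>n. \<xi> \<bullet> e \<noteq> of_int n"
    by (simp add: AE_all_countable)
  then show ?thesis
    by eventually_elim (auto dest!: wave_eq_1_imp_Ints elim!: Ints_cases)
qed

text \<open>The multiplier \<open>1 - \<Sum>\<^sub>k z\<^sup>k / n\<close>, \<open>1 \<le> k \<le> n\<close>, vanishes at \<open>z = 1\<close> and tends to 1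
  elsewhere on the unit circle.\<close>

definition avg_mult :: "nat \<Rightarrow> complex \<Rightarrow> complex"
  where "avg_mult n z = 1 - (\<Sum>k<Suc n. z ^ Suc k) / of_nat (Suc n)"

lemma norm_avg_mult_le_2:
  assumes "norm z = 1"
  shows "norm (avg_mult n z) \<le> 2"
proof -
  have "norm (\<Sum>k<Suc n. z ^ Suc k) \<le> (\<Sum>k<Suc n. norm (z ^ Suc k))" by (rule norm_sum)
  also have "\<dots> = real (Suc n)" by (simp only: norm_power assms) simp
  finally have "norm ((\<Sum>k<Suc n. z ^ Suc k) / of_nat (Suc n)) \<le> 1"
    by (simp add: norm_divide del: of_nat_Suc sum.lessThan_Suc)
  then show ?thesis
    unfolding avg_mult_def
    using norm_triangle_ineq4[of 1 "(\<Sum>k<Suc n. z ^ Suc k) / of_nat (Suc n)"]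
    by (simp del: of_nat_Suc sum.lessThan_Suc)
qed

text \<open>The multiplier is an average of terms 1 - z^k, each vanishing linearly at t = 0. This
  linear zero compensates the singular weight in the definition of \<open>dom_A\<close>.\<close>

lemma norm_avg_mult_wave_le: "norm (avg_mult n (wave t)) \<le> 2 * pi * real (Suc n) * \<bar>t\<bar>"
proof -
  have "avg_mult n (wave t) = (\<Sum>k<Suc n. 1 - wave (real (Suc k) * t)) / of_nat (Suc n)"
    by (simp add: avg_mult_def sum_subtractf wave_mult_nat diff_divide_distrib del: sum.lessThan_Suc of_nat_Suc)
  also have "norm \<dots> = norm (\<Sum>k<Suc n. 1 - wave (real (Suc k) * t)) / real (Suc n)"
    by (simp add: norm_divide del: sum.lessThan_Suc of_nat_Suc)
  also have "\<dots> \<le> (\<Sum>k<Suc n. 2 * pi * real (Suc n) * \<bar>t\<bar>) / real (Suc n)"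
  proof (intro divide_right_mono sum_norm_le)
    fix k assume "k \<in> {..<Suc n}"
    then have "2 * pi * \<bar>real (Suc k) * t\<bar> \<le> 2 * pi * real (Suc n) * \<bar>t\<bar>"
      by (simp add: abs_mult mult_right_mono)
    then show "norm (1 - wave (real (Suc k) * t)) \<le> 2 * pi * real (Suc n) * \<bar>t\<bar>"
      using norm_one_minus_wave_le order_trans by blast
  qed simp
  also have "\<dots> = 2 * pi * real (Suc n) * \<bar>t\<bar>" by simp
  finally show ?thesis .
qed

text \<open>For z \<noteq> 1 on the unit circle the geometric sums stay bounded by 2 / |1 - z|, so
  dividing by n + 1 sends them to 0.\<close>

lemma avg_mult_tendsto_1:
  assumes "norm z = 1" "z \<noteq> 1"
  shows "(\<lambda>n. avg_mult n z) \<longlonglongrightarrow> 1"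
proof -
  define C where "C = 2 / norm (1 - z)"
  have le: "norm ((\<Sum>k<Suc n. z ^ Suc k) / of_nat (Suc n)) \<le> C * (1 / real (Suc n))" for n
  proof -
    have "(\<Sum>k<Suc n. z ^ Suc k) = z * ((1 - z ^ Suc n) / (1 - z))"
      using assms(2) by (simp only: power_Suc[of z] sum_distrib_left[symmetric] sum_gp_strict if_False)
    then have "norm (\<Sum>k<Suc n. z ^ Suc k) = norm (1 - z ^ Suc n) / norm (1 - z)"
      using assms(1) by (simp only: norm_mult norm_divide mult_1)
    also have "\<dots> \<le> C"
      unfolding C_def
      using norm_triangle_ineq4[of 1 "z ^ Suc n"] assms(1)
      by (intro divide_right_mono) (simp_all only: norm_power norm_one power_one one_add_one norm_ge_zero)
    finally show ?thesis
      by (simp add: norm_divide divide_right_mono del: of_nat_Suc sum.lessThan_Suc)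
  qed
  have "(\<lambda>n. C * (1 / real (Suc n))) \<longlonglongrightarrow> C * 0"
    by (intro tendsto_intros LIMSEQ_Suc[OF lim_1_over_n])
  then have "(\<lambda>n. (\<Sum>k<Suc n. z ^ Suc k) / of_nat (Suc n)) \<longlonglongrightarrow> 0"
    by (intro Lim_null_comparison[OF always_eventually[rule_format, OF le]]) simp
  then have "(\<lambda>n. 1 - (\<Sum>k<Suc n. z ^ Suc k) / of_nat (Suc n)) \<longlonglongrightarrow> 1 - 0"
    by (intro tendsto_diff tendsto_const)
  then show ?thesis by (simp only: avg_mult_def diff_zero)
qed

lemma fourier_translate:
  assumes "f \<in> L1"
  shows "fourier (\<lambda>x. f (- w + x)) \<xi> = wave (\<xi> \<bullet> w) * fourier f \<xi>"
  using fourier_scales[OF scales_translation[of "- w"] L1_measurable[OF assms], of \<xi> "- w" \<xi>] by simp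

text \<open>A power of the character is the multiplier of a translation by a multiple of e, and
  translations preserve \<open>L1\<close> and \<open>L2\<close>.\<close>

lemma fourier_power_sum_ex:
  assumes f: "f \<in> L1 \<inter> L2"
  shows "\<exists>g\<in>L1 \<inter> L2. \<forall>\<xi>. fourier g \<xi> = (\<Sum>k<n. wave (\<xi> \<bullet> e) ^ Suc k) * fourier f \<xi>"
proof (induction n)
  case 0
  have "(\<lambda>x. 0) \<in> L1 \<inter> L2" by (simp add: L1_def L2_def)
  then show ?case by (intro bexI[of _ "\<lambda>x. 0"]) (auto simp: fourier_wave)
next
  case (Suc n)
  then obtain g where g: "g \<in> L1 \<inter> L2"
    "\<And>\<xi>. fourier g \<xi> = (\<Sum>k<n. wave (\<xi> \<bullet> e) ^ Suc k) * fourier f \<xi>" by blast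
  define h where "h x = f (- (real (Suc n) *\<^sub>R e) + x)" for x
  have h: "h \<in> L1 \<inter> L2"
    unfolding h_def using f L1_scales[OF scales_translation] L2_scales[OF scales_translation] by blast
  have "fourier h \<xi> = wave (\<xi> \<bullet> e) ^ Suc n * fourier f \<xi>" for \<xi>
    unfolding h_def using f by (simp only: fourier_translate[of f] Int_iff inner_scaleR_right wave_mult_nat)
  then have "fourier (\<lambda>x. g x + h x) \<xi> = (\<Sum>k<Suc n. wave (\<xi> \<bullet> e) ^ Suc k) * fourier f \<xi>" for \<xi>
    using g h by (simp add: fourier_add distrib_right)
  moreover have "(\<lambda>x. g x + h x) \<in> L1 \<inter> L2" using g h by (auto intro: L1_add L2_add)
  ultimately show ?case by blast
qed

lemma fourier_avg_mult_ex:
  assumes f: "f \<in> L1 \<inter> L2"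
  shows "\<exists>g\<in>L1 \<inter> L2. \<forall>\<xi>. fourier g \<xi> = avg_mult n (wave (\<xi> \<bullet> e)) ^ N * fourier f \<xi>"
proof (induction N)
  case 0
  then show ?case using f by auto
next
  case (Suc N)
  then obtain g where g: "g \<in> L1 \<inter> L2"
    "\<And>\<xi>. fourier g \<xi> = avg_mult n (wave (\<xi> \<bullet> e)) ^ N * fourier f \<xi>" by blast
  obtain h where h: "h \<in> L1 \<inter> L2"
    "\<And>\<xi>. fourier h \<xi> = (\<Sum>k<Suc n. wave (\<xi> \<bullet> e) ^ Suc k) * fourier g \<xi>"
    using fourier_power_sum_ex[OF g(1), where n="Suc n" and e=e] by blast
  define u where "u x = g x - 1 / of_nat (Suc n) * h x" for x
  have u: "u \<in> L1 \<inter> L2"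
    unfolding u_def using g(1) h(1) by (intro IntI L1_diff L2_diff L1_cmult L2_cmult) auto
  have "fourier u \<xi> = fourier g \<xi> - 1 / of_nat (Suc n) * fourier h \<xi>" for \<xi>
    unfolding u_def using g(1) h(1)
    by (simp only: fourier_diff[OF _ L1_cmult] fourier_cmult Int_iff)
  then have "fourier u \<xi> = avg_mult n (wave (\<xi> \<bullet> e)) * fourier g \<xi>" for \<xi>
    by (simp add: avg_mult_def h(2) left_diff_distrib del: of_nat_Suc sum.lessThan_Suc)
  then have "fourier u \<xi> = avg_mult n (wave (\<xi> \<bullet> e)) ^ Suc N * fourier f \<xi>" for \<xi>
    by (simp only: g(2) power_Suc mult.assoc)
  then show ?case using u by blast
qed

lemma avg_mult_measurable [measurable]: "avg_mult n \<in> borel_measurable borel"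
  unfolding avg_mult_def by (intro borel_measurable_continuous_onI continuous_intros) (simp del: of_nat_Suc)

text \<open>The transform of an approximant \<open>f0\<close> is multiplied by the power N = d - 1
  of the averaging multiplier. This produces the zero on the hyperplane \<xi>_1 = 0 that
  \<open>dom_A\<close> requires, while the multipliers tend to 1 almost everywhere, so dominated
  convergence and Plancherel bring the functions back to \<open>f0\<close>.\<close>

lemma dom_A_dense:
  fixes f :: "real ^ ('n::finite) option \<Rightarrow> complex"
  assumes f: "f \<in> L2" and "0 < \<epsilon>"
  obtains g where "g \<in> dom_A" "L2_norm (\<lambda>x. g x - f x) < \<epsilon>"
proof -
  obtain f0 C where f0: "f0 \<in> L1 \<inter> L2" "L2_norm (\<lambda>x. f0 x - f x) < \<epsilon> / 2"
    using L2_approx_continuous[OF f, of "\<epsilon> / 2"] \<open>0 < \<epsilon>\<close> by (metis half_gt_zero)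
  define e :: "real ^ 'n option" where "e = axis None 1"
  define N where "N = CARD('n)"
  have e: "\<xi> \<bullet> e = \<xi> $ None" for \<xi> by (simp add: e_def inner_axis)
  have "e \<noteq> 0" by (simp add: e_def axis_eq_0_iff)
  define m where "m n \<xi> = avg_mult n (wave (\<xi> \<bullet> e))" for n \<xi>
  have [measurable]: "m n \<in> borel_measurable borel" for n unfolding m_def by measurable
  have m2: "norm (m n \<xi>) \<le> 2" for n \<xi> by (simp add: m_def norm_avg_mult_le_2)
  have "\<forall>n. \<exists>g\<in>L1 \<inter> L2. \<forall>\<xi>. fourier g \<xi> = m n \<xi> ^ N * fourier f0 \<xi>"
    unfolding m_def using fourier_avg_mult_ex[OF f0(1)] by blast
  then obtain g where g: "\<And>n. g n \<in> L1 \<inter> L2" "\<And>n \<xi>. fourier (g n) \<xi> = m n \<xi> ^ N * fourier f0 \<xi>"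
    by metis
  have F0: "fourier f0 \<in> L2" by (rule fourier_in_L2[OF f0(1)])
  note [measurable] = L2_measurable[OF F0]
  have gA: "g n \<in> dom_A" for n
  proof -
    define K where "K = 2 ^ N * (2 * pi * real (Suc n)) ^ N"
    have int: "integrable lborel (\<lambda>\<xi>. K * (norm (fourier f0 \<xi>))\<^sup>2)"
      using F0 by (simp add: L2_def)
    have "norm ((norm (fourier (g n) \<xi>))\<^sup>2 / \<bar>\<xi> $ None\<bar> ^ N) \<le> norm (K * (norm (fourier f0 \<xi>))\<^sup>2)" for \<xi>
    proof -
      \<comment> \<open>Of the 2N factors in the squared modulus, N are bounded by 2 and the other N
        by the linear estimate, giving exactly the power of |\<xi>_1| to be cancelled.\<close>
      have K: "norm (m n \<xi>) ^ N * norm (m n \<xi>) ^ N \<le> 2 ^ N * ((2 * pi * real (Suc n)) * \<bar>\<xi> $ None\<bar>) ^ N"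
        using m2 norm_avg_mult_wave_le[of n "\<xi> \<bullet> e"]
        by (intro mult_mono power_mono) (auto simp: m_def e simp del: of_nat_Suc)
      have "(norm (fourier (g n) \<xi>))\<^sup>2 = norm (m n \<xi>) ^ N * norm (m n \<xi>) ^ N * (norm (fourier f0 \<xi>))\<^sup>2"
        by (simp add: g(2) norm_mult norm_power power_mult_distrib power2_eq_square)
      also have "\<dots> \<le> 2 ^ N * ((2 * pi * real (Suc n)) * \<bar>\<xi> $ None\<bar>) ^ N * (norm (fourier f0 \<xi>))\<^sup>2"
        using K by (rule mult_right_mono) simp
      also have "\<dots> = K * (norm (fourier f0 \<xi>))\<^sup>2 * \<bar>\<xi> $ None\<bar> ^ N"
        by (simp add: K_def power_mult_distrib mult_ac del: of_nat_Suc)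
      finally have le: "(norm (fourier (g n) \<xi>))\<^sup>2 \<le> K * (norm (fourier f0 \<xi>))\<^sup>2 * \<bar>\<xi> $ None\<bar> ^ N" .
      have "0 \<le> K * (norm (fourier f0 \<xi>))\<^sup>2" by (simp add: K_def)
      \<comment> \<open>On the hyperplane itself the quotient is a division by zero, hence 0, since
        N > 0.\<close>
      then have "(norm (fourier (g n) \<xi>))\<^sup>2 / \<bar>\<xi> $ None\<bar> ^ N \<le> K * (norm (fourier f0 \<xi>))\<^sup>2"
        using le by (cases "\<xi> $ None = 0") (auto simp: pos_divide_le_eq N_def power_0_left)
      moreover have "0 \<le> (norm (fourier (g n) \<xi>))\<^sup>2 / \<bar>\<xi> $ None\<bar> ^ N" by simp
      ultimately show ?thesis by simp
    qed
    moreover have "(\<lambda>\<xi>. (norm (fourier (g n) \<xi>))\<^sup>2 / \<bar>\<xi> $ None\<bar> ^ N) \<in> borel_measurable borel"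
      unfolding g(2) e[symmetric] by measurable
    ultimately have "integrable lborel (\<lambda>\<xi>. (norm (fourier (g n) \<xi>))\<^sup>2 / \<bar>\<xi> $ None\<bar> ^ N)"
      by (intro Bochner_Integration.integrable_bound[OF int]) auto
    then show ?thesis using g(1)[of n] by (simp add: dom_A_def N_def)
  qed
  have "L2_tendsto (\<lambda>n. fourier (g n)) (fourier f0)"
  proof (rule L2_dominated_convergence)
    show "(\<lambda>\<xi>. 2 ^ N * fourier f0 \<xi>) \<in> L2" by (rule L2_cmult[OF F0])
    show "norm (fourier (g n) \<xi>) \<le> norm (2 ^ N * fourier f0 \<xi>)" for n \<xi>
      using m2[of n \<xi>] by (simp add: g(2) norm_mult norm_power mult_right_mono power_mono)
    show "AE \<xi> in lborel. (\<lambda>n. fourier (g n) \<xi>) \<longlonglongrightarrow> fourier f0 \<xi>"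
      using AE_wave_inner_neq_1[OF \<open>e \<noteq> 0\<close>]
    proof eventually_elim
      case (elim \<xi>)
      then have "(\<lambda>n. m n \<xi> ^ N * fourier f0 \<xi>) \<longlonglongrightarrow> 1 ^ N * fourier f0 \<xi>"
        unfolding m_def by (intro tendsto_intros avg_mult_tendsto_1) auto
      then show ?case by (simp add: g(2))
    qed
    show "fourier (g n) \<in> borel_measurable borel" for n
      by (rule L2_measurable[OF fourier_in_L2[OF g(1)]])
  qed simp
  then have "(\<lambda>n. L2_norm (\<lambda>\<xi>. fourier (g n) \<xi> - fourier f0 \<xi>)) \<longlonglongrightarrow> 0"
    by (subst (asm) L2_tendsto_norm_iff) (auto intro: F0 fourier_in_L2[OF g(1)])
  moreover have "L2_norm (\<lambda>\<xi>. fourier (g n) \<xi> - fourier f0 \<xi>) = L2_norm (\<lambda>x. g n x - f0 x)" for n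
  proof -
    have "(\<lambda>\<xi>. fourier (g n) \<xi> - fourier f0 \<xi>) = fourier (\<lambda>x. g n x - f0 x)"
      using f0(1) g(1)[of n] by (simp add: fourier_diff fun_eq_iff)
    then show ?thesis using f0(1) g(1)[of n] by (simp add: plancherel L1_diff L2_diff)
  qed
  ultimately have "eventually (\<lambda>n. L2_norm (\<lambda>x. g n x - f0 x) < \<epsilon> / 2) sequentially"
    using \<open>0 < \<epsilon>\<close> by (intro order_tendstoD(2)[of _ 0]) auto
  then obtain n where "L2_norm (\<lambda>x. g n x - f0 x) < \<epsilon> / 2"
    by (auto dest: eventually_happens)
  then have "L2_norm (\<lambda>x. g n x - f x) < \<epsilon>"
    using L2_norm_triangle[of "g n" f0 f] f0 g(1)[of n] f by simp
  then show ?thesis using that gA by blast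
qed

section \<open>The intertwining property\<close>

text \<open>The duality relation forces both maps to be injective: a kernel vector of either would
  be orthogonal to everything.\<close>

lemma scales_adjoint:
  fixes L N :: "'a::euclidean_space \<Rightarrow> 'a"
  assumes "linear L" "linear N" and adj: "\<And>\<xi> x. N \<xi> \<bullet> L x = \<xi> \<bullet> x"
  obtains c c' where "scales_lborel (\<lambda>x. w + L x) c" "scales_lborel N c'"
proof -
  have "inj L"
    unfolding linear_injective_0[OF \<open>linear L\<close>] using adj by (metis inner_eq_zero_iff inner_zero_right)
  moreover have "inj N"
    unfolding linear_injective_0[OF \<open>linear N\<close>] using adj by (metis inner_eq_zero_iff inner_zero_left)
  ultimately obtain c c' where "scales_lborel (\<lambda>x. w + L x) c" "scales_lborel (\<lambda>x. 0 + N x) c'"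
    using scales_linear_ex[of L w] scales_linear_ex[of N 0] assms by metis
  then show ?thesis using that by simp
qed

text \<open>Since \<open>N\<close> multiplies the first frequency coordinate by a, the weight
  |\<xi>_1|^(-(d-1)) at \<xi> is a constant multiple of the weight at
  \<open>N \<xi>\<close>.\<close>

lemma dom_A_affine:
  fixes f :: "real ^ ('n::finite) option \<Rightarrow> complex" and L N :: "real ^ 'n option \<Rightarrow> real ^ 'n option"
  assumes f: "f \<in> dom_A" and LN: "linear L" "linear N" "\<And>\<xi> x. N \<xi> \<bullet> L x = \<xi> \<bullet> x"
    and None: "\<And>\<xi>. N \<xi> $ None = a * \<xi> $ None" and "a \<noteq> 0"
  shows "(\<lambda>x. k * f (w + L x)) \<in> dom_A"
proof -
  obtain c c' where T: "scales_lborel (\<lambda>x. w + L x) c" and N: "scales_lborel N c'"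
    using scales_adjoint[OF LN] by blast
  have f12: "f \<in> L1" "f \<in> L2" using f by (auto simp: dom_A_def)
  let ?m = "CARD('n)"
  define \<Phi> where "\<Phi> \<xi> = (norm (fourier f \<xi>))\<^sup>2 / \<bar>\<xi> $ None\<bar> ^ ?m" for \<xi>
  have "integrable lborel \<Phi>" using f by (simp add: dom_A_def \<Phi>_def[abs_def])
  then have "integrable lborel (\<lambda>\<xi>. (norm k * c)\<^sup>2 * \<bar>a\<bar> ^ ?m * \<Phi> (N \<xi>))"
    by (intro integrable_mult_right scales_integrable[OF N])
  moreover have "(norm (fourier (\<lambda>x. k * f (w + L x)) \<xi>))\<^sup>2 / \<bar>\<xi> $ None\<bar> ^ ?m
      = (norm k * c)\<^sup>2 * \<bar>a\<bar> ^ ?m * \<Phi> (N \<xi>)" for \<xi>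
  proof -
    have "fourier (\<lambda>x. k * f (w + L x)) \<xi> = k * (of_real c * wave (- (N \<xi> \<bullet> w)) * fourier f (N \<xi>))"
      using fourier_scales[OF T L1_measurable[OF f12(1)], of "N \<xi>" w \<xi>] LN(3)
      by (simp add: fourier_cmult)
    then show ?thesis
      using \<open>a \<noteq> 0\<close>
      by (simp add: \<Phi>_def None norm_mult power_mult_distrib abs_mult field_simps)
  qed
  ultimately have "integrable lborel (\<lambda>\<xi>. (norm (fourier (\<lambda>x. k * f (w + L x)) \<xi>))\<^sup>2 / \<bar>\<xi> $ None\<bar> ^ ?m)"
    by simp
  then show ?thesis
    unfolding dom_A_def using L1_cmult[OF L1_scales[OF T f12(1)]] L2_cmult[OF L2_scales[OF T f12(2)]]
    by simp
qed

text \<open>The multiplier of I depends on the last frequency alone, which \<open>N\<close> scales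
  by a, so passing from \<xi> to \<open>N \<xi>\<close> costs the factor |a|^((d-1)/2). The scaling
  constant and the unimodular factor appear in both transforms; injectivity of the Fourier transform
  concludes.\<close>

lemma op_I_affine:
  fixes F :: "(real ^ 'n::finite) \<times> real \<Rightarrow> complex"
    and L N :: "(real ^ 'n) \<times> real \<Rightarrow> (real ^ 'n) \<times> real"
  assumes FG: "op_I F G" and FG': "op_I (\<lambda>z. k * F (w + L z)) G'"
    and LN: "linear L" "linear N" "\<And>\<xi> x. N \<xi> \<bullet> L x = \<xi> \<bullet> x"
    and snd: "\<And>\<xi>. snd (N \<xi>) = a * snd \<xi>" and "a \<noteq> 0"
  shows "AE z in lborel. G' z = k * of_real (\<bar>a\<bar> powr (- (real CARD('n) / 2))) * G (w + L z)"
proof -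
  define p where "p = real CARD('n) / 2"
  obtain c c' where T: "scales_lborel (\<lambda>x. w + L x) c" and N: "scales_lborel N c'"
    using scales_adjoint[OF LN] by blast
  have adj: "N \<xi> \<bullet> ((w + L x) - w) = \<xi> \<bullet> x" for \<xi> x using LN(3) by simp
  obtain f h where f: "fourier_L2 F f" and h: "fourier_L2 G h"
    and fh: "AE \<xi> in lborel. h \<xi> = of_real (\<bar>snd \<xi>\<bar> powr p) * f \<xi>"
    using FG unfolding op_I_def p_def by (auto simp: case_prod_beta)
  obtain f' h' where f': "fourier_L2 (\<lambda>z. k * F (w + L z)) f'" and h': "fourier_L2 G' h'"
    and fh': "AE \<xi> in lborel. h' \<xi> = of_real (\<bar>snd \<xi>\<bar> powr p) * f' \<xi>"
    using FG' unfolding op_I_def p_def by (auto simp: case_prod_beta)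
  have 1: "AE \<xi> in lborel. f' \<xi> = k * (of_real c * (wave (- (N \<xi> \<bullet> w)) * f (N \<xi>)))"
    by (rule fourier_L2_unique[OF f' fourier_L2_cmult[OF fourier_L2_scales[OF f T N adj]]])
  have 2: "AE \<xi> in lborel. h (N \<xi>) = of_real (\<bar>snd (N \<xi>)\<bar> powr p) * f (N \<xi>)"
    by (rule scales_AE[OF N fh])
  define q where "q = k * of_real (\<bar>a\<bar> powr (- p))"
  have "AE \<xi> in lborel. h' \<xi> = q * (of_real c * (wave (- (N \<xi> \<bullet> w)) * h (N \<xi>)))"
    using 1 2 fh'
  proof eventually_elim
    case (elim \<xi>)
    have "\<bar>snd (N \<xi>)\<bar> powr p = \<bar>a\<bar> powr p * \<bar>snd \<xi>\<bar> powr p"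
      by (simp add: snd abs_mult powr_mult)
    moreover have "\<bar>a\<bar> powr (- p) * \<bar>a\<bar> powr p = 1"
      using \<open>a \<noteq> 0\<close> by (simp flip: powr_add)
    then have "complex_of_real (\<bar>a\<bar> powr (- p)) * complex_of_real (\<bar>a\<bar> powr p) = 1"
      by (simp flip: of_real_mult)
    ultimately show ?case using elim by (simp add: q_def)
  qed
  with h' fourier_L2_cmult[OF fourier_L2_scales[OF h T N adj], of q]
  have "AE z in lborel. G' z = q * G (w + L z)"
    by (rule fourier_L2_inject)
  then show ?thesis by (simp add: q_def p_def)
qed

section \<open>Unitary operators and equality on a dense set\<close>

lemma L2_norm_conv_inner:
  assumes "f \<in> L2"
  shows "L2_norm f = sqrt (Re (L2_inner f f))"
proof -
  have "L2_inner f f = of_real (LINT x|lborel. (norm (f x))\<^sup>2)"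
    unfolding L2_inner_def by (simp only: complex_norm_square[symmetric] integral_complex_of_real)
  moreover have "L2_sq f = ennreal (LINT x|lborel. (norm (f x))\<^sup>2)"
    using assms unfolding L2_sq_def L2_def by (intro nn_integral_eq_integral) auto
  ultimately show ?thesis by (simp add: L2_norm_def)
qed

lemma L2_unitary_diff:
  assumes U: "L2_unitary U" and f: "f \<in> L2" and g: "g \<in> L2"
  shows "L2_norm (\<lambda>x. U f x - U g x) = L2_norm (\<lambda>x. f x - g x)"
proof -
  have mem: "U h \<in> L2" if "h \<in> L2" for h using U that by (simp add: L2_unitary_def)
  have g': "(\<lambda>x. (- 1) * g x) \<in> L2" using L2_cmult[OF g] .
  have "AE x in lborel. U (\<lambda>x. (- 1) * g x) x = (- 1) * U g x"
    using U g unfolding L2_unitary_def by blast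
  moreover have "AE x in lborel. U (\<lambda>x. f x + (- 1) * g x) x = U f x + U (\<lambda>x. (- 1) * g x) x"
  proof -
    have "\<forall>f\<in>L2. \<forall>g\<in>L2. AE y in lborel. U (\<lambda>x. f x + g x) y = U f y + U g y"
      using U by (simp add: L2_unitary_def)
    from bspec[OF bspec[OF this f] g'] show ?thesis .
  qed
  ultimately have "AE x in lborel. U f x - U g x = U (\<lambda>x. f x - g x) x"
    by eventually_elim simp
  then have "L2_norm (\<lambda>x. U f x - U g x) = L2_norm (U (\<lambda>x. f x - g x))"
    by (rule L2_norm_cong)
  also have "\<dots> = L2_norm (\<lambda>x. f x - g x)"
    using U L2_diff[OF f g] mem by (simp add: L2_norm_conv_inner L2_unitary_def)
  finally show ?thesis .
qed

lemma L2_dense_AE_eq: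
  assumes dense: "\<And>e. 0 < e \<Longrightarrow> \<exists>g\<in>A. L2_norm (\<lambda>x. g x - f x) < e" and A: "A \<subseteq> L2" and f: "f \<in> L2"
    and X: "\<And>g. g \<in> L2 \<Longrightarrow> X g \<in> L2"
      "\<And>g. g \<in> L2 \<Longrightarrow> L2_norm (\<lambda>x. X g x - X f x) \<le> C * L2_norm (\<lambda>x. g x - f x)"
    and Y: "\<And>g. g \<in> L2 \<Longrightarrow> Y g \<in> L2"
      "\<And>g. g \<in> L2 \<Longrightarrow> L2_norm (\<lambda>x. Y g x - Y f x) \<le> D * L2_norm (\<lambda>x. g x - f x)"
    and eq: "\<And>g. g \<in> A \<Longrightarrow> AE x in lborel. X g x = Y g x"
  shows "AE x in lborel. X f x = Y f x"
proof -
  have "L2_norm (\<lambda>x. X f x - Y f x) \<le> 0 + e" if "0 < e" for e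
  proof -
    \<comment> \<open>Absolute values and the added 1 keep the denominator positive whatever the
      signs of C and D.\<close>
    define \<delta> where "\<delta> = e / (\<bar>C\<bar> + \<bar>D\<bar> + 1)"
    have "0 < \<delta>" using that by (simp add: \<delta>_def)
    then obtain g where g: "g \<in> A" "L2_norm (\<lambda>x. g x - f x) < \<delta>" using dense by blast
    have gL: "g \<in> L2" using g A by blast
    let ?d = "L2_norm (\<lambda>x. g x - f x)"
    have "L2_norm (\<lambda>x. X f x - Y f x) \<le> L2_norm (\<lambda>x. X f x - X g x) + L2_norm (\<lambda>x. X g x - Y f x)"
      by (intro L2_norm_triangle X Y f gL)
    also have "L2_norm (\<lambda>x. X g x - Y f x) = L2_norm (\<lambda>x. Y g x - Y f x)"
      using eq[OF g(1)] by (intro L2_norm_cong) (auto elim!: eventually_mono)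
    also have "L2_norm (\<lambda>x. X f x - X g x) = L2_norm (\<lambda>x. X g x - X f x)"
      by (rule L2_norm_diff_commute)
    also have "L2_norm (\<lambda>x. X g x - X f x) + L2_norm (\<lambda>x. Y g x - Y f x) \<le> C * ?d + D * ?d"
      by (intro add_mono X Y gL)
    also have "\<dots> \<le> (\<bar>C\<bar> + \<bar>D\<bar> + 1) * ?d"
      by (simp add: distrib_right add_mono mult_right_mono add_increasing2)
    also have "\<dots> \<le> (\<bar>C\<bar> + \<bar>D\<bar> + 1) * \<delta>"
      using g(2) by (intro mult_left_mono) auto
    also have "\<dots> = e" by (simp add: \<delta>_def)
    finally show ?thesis by simp
  qed
  then have "L2_norm (\<lambda>x. X f x - Y f x) \<le> 0" by (rule field_le_epsilon)
  then have "L2_norm (\<lambda>x. X f x - Y f x) = 0" by (simp add: antisym)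
  then have "AE x in lborel. X f x - Y f x = 0"
    by (intro L2_norm_eq_0 L2_diff X Y f)
  then show ?thesis by simp
qed

section \<open>The matrices of the dilation group in block form\<close>

lemma
  fixes A :: "real ^ 'n ^ ('m::finite)"
  assumes "invertible A"
  shows matrix_inv_right: "A ** matrix_inv A = mat 1"
    and matrix_inv_left: "matrix_inv A ** A = mat 1"
  using someI_ex[OF assms[unfolded invertible_def]] by (simp_all add: matrix_inv_def)

definition vtail :: "real ^ ('n::finite) option \<Rightarrow> real ^ 'n"
  where "vtail x = (\<chi> k. x $ Some k)"

lemma vcons_nth [simp]: "vcons x y $ None = x" "vcons x y $ Some k = y $ k"
  by (simp_all add: vcons_def)

lemma vtail_vcons [simp]: "vtail (vcons x y) = y"
  by (simp add: vtail_def vec_eq_iff)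

lemma vec_option_eq_iff: "x = y \<longleftrightarrow> x $ None = y $ None \<and> vtail x = vtail y"
  for x y :: "real ^ ('n::finite) option"
  by (auto simp: vec_eq_iff vtail_def) (metis not_None_eq)

lemma vtail_diff: "vtail (x - y) = vtail x - vtail y"
  by (simp add: vtail_def vec_eq_iff)

lemma inner_nvec: "nvec v \<bullet> b = b $ None + v \<bullet> vtail b"
  by (simp add: inner_vec_def sum_UNIV_option nvec_def vtail_def)

lemma continuous_on_vcons:
  assumes "continuous_on A f" "continuous_on A g"
  shows "continuous_on A (\<lambda>x. vcons (f x) (g x))"
proof -
  have "continuous_on A (\<lambda>x. case i of None \<Rightarrow> f x | Some k \<Rightarrow> g x $ k)" for i
    using assms by (cases i) (auto intro!: continuous_intros)
  then show ?thesis unfolding vcons_def by (rule continuous_on_vec_lambda)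
qed

lemma hmat_mult_vcons:
  "hmat B lam s a *v vcons x z
    = vcons (a * (x - (s v* Lam lam a) \<bullet> z)) (a *\<^sub>R ((B s ** Lam lam a) *v z))"
  unfolding vec_option_eq_iff
  by (auto simp: hmat_def block_def vtail_def vec_eq_iff sum_UNIV_option inner_vec_def
      matrix_vector_mult_def[of "_ *\<^sub>R _"] matrix_vector_mult_def[of "B s ** Lam lam a"]
      sum_distrib_left sum_negf algebra_simps)

lemma transpose_hmat_None: "(transpose (hmat B lam s a) *v \<xi>) $ None = a * \<xi> $ None"
  by (simp add: matrix_vector_mult_def transpose_def hmat_def block_def sum_UNIV_option)

lemma invertible_hmat:
  assumes "shearlet_dilation_group H B lam" "a \<noteq> 0"
  shows "invertible (hmat B lam s a)"
proof -
  have "hmat B lam s a \<in> H"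
    using assms by (auto simp: shearlet_dilation_group_def hmat_eq_shear_dil)
  then show ?thesis
    using assms subgroup.subset[of H GL] by (auto simp: shearlet_dilation_group_def GL_def)
qed

lemma inj_hmat_block:
  assumes "shearlet_dilation_group H B lam" "a \<noteq> 0"
  shows "inj ((*v) (B s ** Lam lam a))"
proof -
  have "z = 0" if "(B s ** Lam lam a) *v z = 0" for z
  proof -
    \<comment> \<open>The first entry is chosen to cancel the first row, so a kernel vector of the
      block extends to a kernel vector of the whole invertible matrix.\<close>
    have "hmat B lam s a *v vcons ((s v* Lam lam a) \<bullet> z) z = 0"
      by (simp add: hmat_mult_vcons that vec_option_eq_iff) (simp add: vtail_def vec_eq_iff)
    moreover have "inj ((*v) (hmat B lam s a))"
      using invertible_hmat[OF assms] by (simp add: invertible_left_inverse matrix_left_invertible_injective)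
    ultimately have "vcons ((s v* Lam lam a) \<bullet> z) z = 0"
      by (metis injD matrix_vector_mult_0_right)
    then show "z = 0" by (metis vec_eq_iff vcons_nth(2) zero_index)
  qed
  then show ?thesis
    by (simp add: linear_injective_0[OF matrix_vector_mul_linear])
qed

lemma Lam_mult: "Lam lam a *v z = (\<chi> i. \<bar>a\<bar> powr (lam $ i) * z $ i)"
  by (simp add: Lam_def matrix_vector_mult_def vec_eq_iff if_distrib[of "\<lambda>x. x * _"] cong: if_cong)

lemma transpose_Lam: "transpose (Lam lam a) = Lam lam a"
  by (simp add: transpose_def Lam_def vec_eq_iff)

lemma Lam_one: "Lam lam 1 = mat 1"
  by (simp add: Lam_def mat_def vec_eq_iff)

text \<open>The unipotent factor contributes 1 and the diagonal factor the product of its inverse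
  entries. Injectivity of \<open>B s\<close> is the case a = 1 of the block, where Lambda is the
  identity.\<close>

lemma scales_hmat_block:
  assumes H: "shearlet_dilation_group H B lam" and "a \<noteq> 0"
  shows "scales_lborel ((*v) (B s ** Lam lam a)) (\<bar>a\<bar> powr (- lamD lam))"
proof -
  have "scales_lborel ((*v) (B s)) 1"
  proof (rule scales_unipotent)
    show "B s \<in> unipotent_upper" using H by (auto simp: shearlet_dilation_group_def)
    show "inj ((*v) (B s))" using inj_hmat_block[OF H, of 1 s] by (simp add: Lam_one)
  qed
  moreover have "scales_lborel (\<lambda>z. Lam lam a *v z) (\<Prod>i\<in>UNIV. inverse (\<bar>a\<bar> powr (lam $ i)))"
    unfolding Lam_mult using \<open>a \<noteq> 0\<close> by (intro scales_diagonal) simp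
  moreover have "(\<Prod>i\<in>UNIV. inverse (\<bar>a\<bar> powr (lam $ i))) = \<bar>a\<bar> powr (- lamD lam)"
    using \<open>a \<noteq> 0\<close> by (simp add: powr_minus[symmetric] lamD_def sum_negf[symmetric] powr_sum)
  ultimately show ?thesis
    using scales_compose by (fastforce simp: matrix_vector_mul_assoc)
qed

text \<open>With (v', t') the argument on the right, x -> h x + b maps the hyperplane n(v') . x = t'
  onto n(v) . x = t. In the coordinates of the two hyperplanes this map is \<phi>. The identity
  holds at every (v, t): the change of variables respects the value 0 given to divergent
  integrals.\<close>

lemma radon_aff_shearlet_rep:
  fixes f :: "real ^ ('n::{finite,linorder}) option \<Rightarrow> complex"
  assumes H: "shearlet_dilation_group H B lam" and a: "a \<noteq> 0"
    and [measurable]: "f \<in> borel_measurable borel"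
  shows "radon_aff (shearlet_rep B lam b s a f) (v, t)
    = of_real (\<bar>a\<bar> powr ((real CARD('n) - 1 + lamD lam) / 2))
      * radon_aff f (Lam lam a *v (transpose (B s) *v v - s), (t - nvec v \<bullet> b) / a)"
proof -
  define M where "M = B s ** Lam lam a"
  define h where "h = hmat B lam s a"
  define c0 where "c0 = s v* Lam lam a"
  define v' where "v' = Lam lam a *v (transpose (B s) *v v - s)"
  define t' where "t' = (t - nvec v \<bullet> b) / a"
  define k where "k = complex_of_real (\<bar>a\<bar> powr (- (real CARD('n option) + lamD lam) / 2))"
  define \<phi> where "\<phi> z = vtail b + a *\<^sub>R (M *v z)" for z
  define m where "m = CARD('n)"
  define F where "F y = k * f (matrix_inv h *v (vcons (t - v \<bullet> y) y - b))" for y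
  have inv: "invertible h" unfolding h_def by (rule invertible_hmat[OF H a])
  have "continuous_on UNIV (\<lambda>y. matrix_inv h *v (vcons (t - v \<bullet> y) y - b))"
    by (intro continuous_on_compose2[OF matrix_vector_mult_linear_continuous_on[of UNIV "matrix_inv h"]]
        continuous_intros continuous_on_vcons) auto
  then have [measurable]: "(\<lambda>y. matrix_inv h *v (vcons (t - v \<bullet> y) y - b)) \<in> borel_measurable borel"
    by (rule borel_measurable_continuous_onI)
  have [measurable]: "F \<in> borel_measurable borel" unfolding F_def by measurable
  \<comment> \<open>In inner products, v' is the transpose of \<open>M\<close> applied to v, minus
    the row of \<open>h\<close>: exactly what makes the first coordinates match in the next
    step.\<close>
  have v': "v' \<bullet> z = v \<bullet> (M *v z) - c0 \<bullet> z" for z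
  proof -
    have "v' = transpose M *v v - c0"
      by (simp add: v'_def M_def c0_def matrix_vector_mult_diff_distrib matrix_transpose_mul
          transpose_Lam matrix_vector_mul_assoc flip: transpose_matrix_vector)
    then show ?thesis
      by (simp add: inner_diff_left transpose_matrix_vector dot_lmul_matrix)
  qed
  have F\<phi>: "F (\<phi> z) = k * f (vcons (t' - v' \<bullet> z) z)" for z
  proof -
    have "h *v vcons (t' - v' \<bullet> z) z = vcons (t - v \<bullet> \<phi> z) (\<phi> z) - b"
      unfolding h_def hmat_mult_vcons vec_option_eq_iff
      using a by (simp add: vtail_diff v' \<phi>_def t'_def M_def[symmetric] c0_def[symmetric] inner_nvec
          inner_add_right field_simps)
    then have "matrix_inv h *v (vcons (t - v \<bullet> \<phi> z) (\<phi> z) - b)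
        = (matrix_inv h ** h) *v vcons (t' - v' \<bullet> z) z"
      by (simp only: matrix_vector_mul_assoc[symmetric])
    then show ?thesis using inv by (simp add: F_def matrix_inv_left)
  qed
  have "scales_lborel \<phi> (inverse (\<bar>a\<bar> ^ m) * \<bar>a\<bar> powr (- lamD lam))"
    unfolding \<phi>_def M_def m_def
    using scales_compose[OF scales_affine[OF a] scales_hmat_block[OF H a], of "vtail b" s] by simp
  then have *: "(LINT z|lborel. F (\<phi> z)) = (inverse (\<bar>a\<bar> ^ m) * \<bar>a\<bar> powr (- lamD lam)) *\<^sub>R (LINT y|lborel. F y)"
    by (rule scales_integral) simp
  have "(LINT y|lborel. F y) = (\<bar>a\<bar> ^ m * \<bar>a\<bar> powr lamD lam) *\<^sub>R (LINT z|lborel. F (\<phi> z))"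
  proof -
    have "\<bar>a\<bar> ^ m * \<bar>a\<bar> powr lamD lam * (inverse (\<bar>a\<bar> ^ m) * \<bar>a\<bar> powr (- lamD lam)) = 1"
      using a by (simp add: powr_minus field_simps)
    with * show ?thesis by simp
  qed
  also have "(LINT z|lborel. F (\<phi> z)) = k * radon_aff f (v', t')"
    by (simp add: F\<phi> radon_aff_def)
  also have "(LINT y|lborel. F y) = radon_aff (shearlet_rep B lam b s a f) (v, t)"
    by (simp add: radon_aff_def shearlet_rep_def F_def k_def h_def)
  also have "(\<bar>a\<bar> ^ m * \<bar>a\<bar> powr lamD lam) *\<^sub>R (k * radon_aff f (v', t'))
      = of_real (\<bar>a\<bar> ^ m * \<bar>a\<bar> powr lamD lam * \<bar>a\<bar> powr (- (real CARD('n option) + lamD lam) / 2))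
        * radon_aff f (v', t')"
    by (simp add: k_def scaleR_conv_of_real)
  also have "\<bar>a\<bar> ^ m * \<bar>a\<bar> powr lamD lam * \<bar>a\<bar> powr (- (real CARD('n option) + lamD lam) / 2)
      = \<bar>a\<bar> powr (real m + lamD lam + - (real CARD('n option) + lamD lam) / 2)"
    unfolding powr_add using a powr_realpow[of "\<bar>a\<bar>" m] by simp
  \<comment> \<open>Here d = m + 1, so half of d + lambda_D is subtracted from d - 1 +
    lambda_D.\<close>
  also have "real m + lamD lam + - (real CARD('n option) + lamD lam) / 2 = (real CARD('n) - 1 + lamD lam) / 2"
    by (simp add: m_def card_UNIV_option field_simps)
  finally show ?thesis by (simp add: v'_def t'_def)
qed

theorem theorem10:
  fixes H :: "(real ^ ('n::{finite,linorder}) option ^ 'n option) set"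
    and B :: "real ^ 'n::{finite,linorder} \<Rightarrow> real ^ 'n::{finite,linorder} ^ 'n::{finite,linorder}"
    and lam :: "real ^ 'n::{finite,linorder}"
    and Q :: "(real ^ ('n::{finite,linorder}) option \<Rightarrow> complex)
      \<Rightarrow> (real ^ 'n::{finite,linorder}) \<times> real \<Rightarrow> complex"
  assumes "shearlet_dilation_group H B lam"
    and "unitary_affine_radon Q"
  shows "\<forall>f\<in>L2. \<forall>b s a. a \<noteq> 0 \<longrightarrow>
    (AE (v, t) in lborel.
      Q (shearlet_rep B lam b s a f) (v, t) = VW_rep B lam b s a (Q f) (v, t))"
proof (intro ballI allI impI)
  fix f :: "real ^ 'n option \<Rightarrow> complex" and b s and a :: real
  assume f: "f \<in> L2" and a: "a \<noteq> 0"
  note H = assms(1)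
  have U: "L2_unitary Q" and QA: "\<And>g. g \<in> dom_A \<Longrightarrow> op_I (radon_aff g) (Q g)"
    using assms(2) by (auto simp: unitary_affine_radon_def)
  have QL2: "\<And>g. g \<in> L2 \<Longrightarrow> Q g \<in> L2" using U by (simp add: L2_unitary_def)
  define M where "M = B s ** Lam lam a"
  define h where "h = hmat B lam s a"
  have inv: "invertible h" unfolding h_def by (rule invertible_hmat[OF H a])
  have invM: "invertible M"
    using inj_hmat_block[OF H a] by (simp add: M_def invertible_left_inverse matrix_left_invertible_injective)

  define k where "k = complex_of_real (\<bar>a\<bar> powr (- (real CARD('n option) + lamD lam) / 2))"
  define w where "w = - (matrix_inv h *v b)"
  have S: "shearlet_rep B lam b s a g = (\<lambda>x. k * g (w + matrix_inv h *v x))" for g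
    by (simp add: shearlet_rep_def fun_eq_iff k_def w_def h_def matrix_vector_mult_diff_distrib)
  \<comment> \<open>The transpose of \<open>h\<close> is the adjoint inverse of the linear part of
    S. It multiplies the first frequency by a because the first column of \<open>h\<close> is (a,
    0).\<close>
  have adj: "(transpose h *v \<xi>) \<bullet> (matrix_inv h *v x) = \<xi> \<bullet> x" for \<xi> x
    using inv by (simp add: transpose_matrix_vector dot_lmul_matrix matrix_vector_mul_assoc matrix_inv_right)
  obtain c where T: "scales_lborel (\<lambda>x. w + matrix_inv h *v x) c"
    using scales_adjoint[OF matrix_vector_mul_linear matrix_vector_mul_linear adj] by blast

  \<comment> \<open>The linear part of the map of (v, t) in the claim: n(v) . b splits into the
    constant first entry of b, kept in \<open>w2\<close>, and the part linear in v, kept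
    here.\<close>
  define L2' where "L2' z = (transpose M *v fst z, (snd z - fst z \<bullet> vtail b) / a)" for z :: "(real, 'n) vec \<times> real"
  \<comment> \<open>Solving the duality relation with \<open>L2'\<close> gives this map. The
    dependence of the translation on v only adds a multiple of \<tau> to the first frequency
    component, while the second stays a \<tau>.\<close>
  define N2 where "N2 \<xi> = (matrix_inv M *v (fst \<xi> + snd \<xi> *\<^sub>R vtail b), a * snd \<xi>)" for \<xi> :: "(real, 'n) vec \<times> real"
  define w2 where "w2 = (- (Lam lam a *v s), - (b $ None) / a)"
  have lin2: "linear L2'" "linear N2"
    unfolding L2'_def N2_def
    by (rule linearI; simp add: matrix_vector_right_distrib matrix_vector_mult_scaleR inner_add_left
        scaleR_add_left scaleR_add_right add_divide_distrib diff_divide_distrib algebra_simps)+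
  have adj2: "N2 \<xi> \<bullet> L2' z = \<xi> \<bullet> z" for \<xi> z
  proof -
    have "(matrix_inv M *v x) \<bullet> (transpose M *v y) = x \<bullet> y" for x y
      using invM
      by (simp add: transpose_matrix_vector dot_lmul_matrix matrix_vector_mul_assoc matrix_inv_right
          inner_commute[of "matrix_inv M *v x"] inner_commute[of y])
    then show ?thesis
      using a by (simp add: N2_def L2'_def inner_prod_def inner_add_left inner_commute[of "vtail b"]
          diff_divide_distrib algebra_simps)
  qed
  obtain c2 where T2: "scales_lborel (\<lambda>z. w2 + L2' z) c2"
    using scales_adjoint[OF lin2 adj2] by blast
  have Mt: "transpose M *v v = Lam lam a *v (transpose (B s) *v v)" for v
    by (simp only: M_def matrix_transpose_mul transpose_Lam matrix_vector_mul_assoc)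
  have arg: "w2 + L2' (v, t) = (Lam lam a *v (transpose (B s) *v v - s), (t - nvec v \<bullet> b) / a)" for v t
    by (simp add: w2_def L2'_def Mt matrix_vector_mult_diff_distrib inner_nvec diff_divide_distrib
        add_divide_distrib del: transpose_matrix_vector)
  define q where "q = complex_of_real (\<bar>a\<bar> powr (lamD lam / 2)) * complex_of_real (\<bar>a\<bar> powr (- 1 / 2))"
  have VW: "VW_rep B lam b s a F = (\<lambda>z. q * F (w2 + L2' z))" for F
    by (simp add: fun_eq_iff split_paired_all VW_rep_apply arg q_def)

  have "AE z in lborel. Q (shearlet_rep B lam b s a f) z = VW_rep B lam b s a (Q f) z"
  \<comment> \<open>C and D are the factors by which k times composition with S's affine map, and q
    times composition with the map of (v, t), change the norm; \<open>Q\<close> itself changes no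
    distances.\<close>
  proof (rule L2_dense_AE_eq[where A = dom_A and C = "norm k * sqrt c" and D = "norm q * sqrt c2"])
    show "\<exists>g\<in>dom_A. L2_norm (\<lambda>x. g x - f x) < e" if "0 < e" for e
      using dom_A_dense[OF f that] by blast
    show "dom_A \<subseteq> L2" by (auto simp: dom_A_def)
    show "f \<in> L2" by (rule f)
  next
    fix g :: "real ^ 'n option \<Rightarrow> complex" assume g: "g \<in> L2"
    have Sg: "shearlet_rep B lam b s a g \<in> L2" if "g \<in> L2" for g
      unfolding S by (intro L2_cmult L2_scales[OF T that])
    show "Q (shearlet_rep B lam b s a g) \<in> L2" by (intro QL2 Sg g)
    show "VW_rep B lam b s a (Q g) \<in> L2"
      unfolding VW by (intro L2_cmult L2_scales[OF T2] QL2 g)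
    have "L2_norm (\<lambda>z. Q (shearlet_rep B lam b s a g) z - Q (shearlet_rep B lam b s a f) z)
        = L2_norm (\<lambda>x. shearlet_rep B lam b s a g x - shearlet_rep B lam b s a f x)"
      by (intro L2_unitary_diff U Sg f g)
    also have "\<dots> = L2_norm (\<lambda>x. k * (\<lambda>y. g y - f y) (w + matrix_inv h *v x))"
      by (simp add: S right_diff_distrib)
    also have "\<dots> = norm k * sqrt c * L2_norm (\<lambda>x. g x - f x)"
      using L2_norm_cmult[OF L2_scales[OF T L2_diff[OF g f]]] L2_norm_scales[OF T L2_diff[OF g f]]
      by simp
    finally show "L2_norm (\<lambda>z. Q (shearlet_rep B lam b s a g) z - Q (shearlet_rep B lam b s a f) z)
        \<le> norm k * sqrt c * L2_norm (\<lambda>x. g x - f x)" by simp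
    have QQ: "(\<lambda>z. Q g z - Q f z) \<in> L2" by (intro L2_diff QL2 f g)
    have "L2_norm (\<lambda>z. VW_rep B lam b s a (Q g) z - VW_rep B lam b s a (Q f) z)
        = L2_norm (\<lambda>z. q * (\<lambda>y. Q g y - Q f y) (w2 + L2' z))"
      by (simp add: VW right_diff_distrib)
    also have "\<dots> = norm q * sqrt c2 * L2_norm (\<lambda>z. Q g z - Q f z)"
      using L2_norm_cmult[OF L2_scales[OF T2 QQ]] L2_norm_scales[OF T2 QQ] by simp
    finally show "L2_norm (\<lambda>z. VW_rep B lam b s a (Q g) z - VW_rep B lam b s a (Q f) z)
        \<le> norm q * sqrt c2 * L2_norm (\<lambda>x. g x - f x)"
      by (simp add: L2_unitary_diff[OF U g f])
  next
    fix g :: "real ^ 'n option \<Rightarrow> complex" assume g: "g \<in> dom_A"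
    have "shearlet_rep B lam b s a g \<in> dom_A"
      unfolding S
      by (rule dom_A_affine[OF g matrix_vector_mul_linear matrix_vector_mul_linear adj _ a])
        (simp only: h_def transpose_hmat_None)
    then have 1: "op_I (radon_aff (shearlet_rep B lam b s a g)) (Q (shearlet_rep B lam b s a g))"
      by (rule QA)
    have "radon_aff (shearlet_rep B lam b s a g)
        = (\<lambda>z. of_real (\<bar>a\<bar> powr ((real CARD('n) - 1 + lamD lam) / 2)) * radon_aff g (w2 + L2' z))"
      using radon_aff_shearlet_rep[OF H a, of g b s] g
      by (simp add: fun_eq_iff split_paired_all arg dom_A_def L1_measurable)
    with 1 have "AE z in lborel. Q (shearlet_rep B lam b s a g) z
        = of_real (\<bar>a\<bar> powr ((real CARD('n) - 1 + lamD lam) / 2))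
          * of_real (\<bar>a\<bar> powr (- (real CARD('n) / 2))) * Q g (w2 + L2' z)"
      using op_I_affine[OF QA[OF g] _ lin2 adj2 _ a] by (simp add: N2_def)
    \<comment> \<open>The exponents (d - 2 + lambda_D) / 2 and -(d - 1) / 2 add up to (lambda_D - 1)
      / 2.\<close>
    moreover have "complex_of_real (\<bar>a\<bar> powr ((real CARD('n) - 1 + lamD lam) / 2))
        * complex_of_real (\<bar>a\<bar> powr (- (real CARD('n) / 2))) = q"
      unfolding q_def of_real_mult[symmetric] powr_add[symmetric]
      by (rule arg_cong[where f = "\<lambda>x. complex_of_real (\<bar>a\<bar> powr x)"]) (simp add: field_simps)
    ultimately show "AE z in lborel. Q (shearlet_rep B lam b s a g) z = VW_rep B lam b s a (Q g) z"
      by (simp add: VW)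
  qed
  then show "AE (v, t) in lborel.
      Q (shearlet_rep B lam b s a f) (v, t) = VW_rep B lam b s a (Q f) (v, t)"
    by (simp add: case_prod_beta)
qed

end
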